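(* Let $d\geq 1$ be an integer and consider the equation $$i\partial_t u+\tfrac12\Delta u=-\omega^2\frac{|x|^2}{2}u+\lambda u\ln(|u|^2),\quad x\in\mathbb{R}^d. \qquad (\mathrm{E})$$ (1) Suppose $-\lambda>\omega>0$, and set $k_\pm=-\lambda\pm\sqrt{\lambda^2-\omega^2}$. Then (E) possesses two positive stationary (time-independent) solutions, which are Gaussian functions, namely $$\phi_{k_\pm}(x)=e^{-\frac{dk_\pm}{4\lambda}}e^{-k_\pm|x|^2/2}.$$ Each of them generates a continuous family of solitary waves: for every $\nu\in\mathbb{R}$, $$u_{\pm,\nu}(t,x)=\phi_{k_\pm,\nu}(x)e^{i\nu t},\qquad \phi_{k_\pm,\nu}(x)=e^{-\frac{\nu}{2\lambda}}\phi_{k_\pm}(x),$$ is a solution to (E). For every $\nu\in\mathbb{R}$ and each choice of sign, the solitary wave $u_{\pm,\nu}$ is unstable (in the sense recalled in the context). (2) Suppose $-\lambda=\omega>0$. Then $k_-=k_+=\omega$, and $\phi_{k_-}=\phi_{k_+}=\phi_\omega$, where $\phi_\omega(x)=e^{d/4}e^{-\omega|x|^2/2}$, is a stationary solution to (E) which generates a continuous family of solitary waves: for every $\nu\in\mathbb{R}$, $$u_{\omega,\nu}(t,x)=\phi_{\omega,\nu}(x)e^{i\nu t},\qquad \phi_{\omega,\nu}(x)=e^{\frac{\nu}{2\omega}}\phi_\omega(x),$$ is a solution to (E). For every $\nu\in\mathbb{R}$, the solitary wave $u_{\omega,\nu}$ is unstable (in the same sense).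
   Context: The unknown $u=u(t,x)$ is complex valued, $t\in\mathbb{R}$, $x\in\mathbb{R}^d$, and $u\ln(|u|^2)$ is understood as $0$ where $u=0$. The space $\Sigma$ is $$\Sigma=\{f\in H^1(\mathbb{R}^d)\ :\ x\mapsto |x|f(x)\in L^2(\mathbb{R}^d)\},\qquad \|f\|_\Sigma^2=\|f\|_{L^2}^2+\|\nabla f\|_{L^2}^2+\int_{\mathbb{R}^d}|x|^2|f(x)|^2dx.$$ Known well-posedness: for every $u_0\in\Sigma$, equation (E) has a unique solution $u\in L^\infty_{\rm loc}(\mathbb{R};\Sigma)\cap C(\mathbb{R};L^2(\mathbb{R}^d))$ with $u_{|t=0}=u_0$; "the solution" refers to this one. Definition (stability). A standing wave $u(t,x)=\phi(x)e^{i\nu t}$ solution to (E) is orbitally stable in the energy space if for any $\varepsilon>0$ there exists $\eta>0$ such that if $u_0\in\Sigma$ satisfies $\|u_0-\phi\|_\Sigma<\eta$, then the solution $u$ to (E) with $u_{|t=0}=u_0$ exists for all $t\in\mathbb{R}$ and $$\sup_{t\in\mathbb{R}}\inf_{\theta\in\mathbb{R}}\|u(t)-e^{i\theta}\phi\|_\Sigma<\varepsilon.$$ Otherwise, the standing wave is said to be unstable. *)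

theory Defs
  imports "HOL-Analysis.Analysis"
begin

text \<open>
  The space \<open>\<real>\<^sup>d\<close> is a type \<open>'a::euclidean_space\<close>, with \<open>d = DIM('a) \<ge> 1\<close>. Elements of
  \<open>L\<^sup>2\<close>, \<open>H\<^sup>1\<close> and \<open>\<Sigma>\<close> are represented by Borel functions \<open>'a \<Rightarrow> complex\<close>; the notions
  below depend only on the class modulo Lebesgue-null sets.
\<close>

definition dir_deriv ::
    "'a::euclidean_space \<Rightarrow> ('a \<Rightarrow> 'b::real_normed_vector) \<Rightarrow> 'a \<Rightarrow> 'b" where
  "dir_deriv v f x = frechet_derivative f (at x) v"

primrec Ck :: "nat \<Rightarrow> ('a::euclidean_space \<Rightarrow> 'b::real_normed_vector) \<Rightarrow> bool" where
  "Ck 0 f \<longleftrightarrow> continuous_on UNIV f"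
| "Ck (Suc n) f \<longleftrightarrow> (\<forall>x. f differentiable (at x)) \<and> (\<forall>b\<in>Basis. Ck n (dir_deriv b f))"

definition test_function :: "('a::euclidean_space \<Rightarrow> complex) \<Rightarrow> bool" where
  "test_function \<psi> \<longleftrightarrow> (\<forall>n. Ck n \<psi>) \<and> compact (closure {x. \<psi> x \<noteq> 0})"

definition L2 :: "('a::euclidean_space \<Rightarrow> complex) set" where
  "L2 = {f \<in> borel_measurable lborel. integrable lborel (\<lambda>x. (cmod (f x))\<^sup>2)}"

definition L2_norm :: "('a::euclidean_space \<Rightarrow> complex) \<Rightarrow> real" where
  "L2_norm f = sqrt (LINT x|lborel. (cmod (f x))\<^sup>2)"

definition is_weak_deriv ::
    "'a::euclidean_space \<Rightarrow> ('a \<Rightarrow> complex) \<Rightarrow> ('a \<Rightarrow> complex) \<Rightarrow> bool" where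
  "is_weak_deriv b f g \<longleftrightarrow>
     (\<forall>\<psi>. test_function \<psi> \<longrightarrow>
        (LINT x|lborel. f x * dir_deriv b \<psi> x) = - (LINT x|lborel. g x * \<psi> x))"

definition H1 :: "('a::euclidean_space \<Rightarrow> complex) set" where
  "H1 = {f \<in> L2. \<forall>b\<in>Basis. \<exists>g\<in>L2. is_weak_deriv b f g}"

text \<open>The choice is immaterial: a weak derivative is unique up to a null set.\<close>

definition weak_deriv :: "'a::euclidean_space \<Rightarrow> ('a \<Rightarrow> complex) \<Rightarrow> 'a \<Rightarrow> complex" where
  "weak_deriv b f = (SOME g. g \<in> L2 \<and> is_weak_deriv b f g)"

definition Sigma_space :: "('a::euclidean_space \<Rightarrow> complex) set" where
  "Sigma_space = {f \<in> H1. (\<lambda>x. of_real (norm x) * f x) \<in> L2}"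

definition Sigma_norm :: "('a::euclidean_space \<Rightarrow> complex) \<Rightarrow> real" where
  "Sigma_norm f = sqrt ((L2_norm f)\<^sup>2
     + (\<Sum>b\<in>Basis. (L2_norm (weak_deriv b f))\<^sup>2)
     + (LINT x|lborel. (norm x)\<^sup>2 * (cmod (f x))\<^sup>2))"

text \<open>At \<open>z = 0\<close> the value is \<open>0\<close>, because of the factor \<open>z\<close>.\<close>

definition log_nonlin :: "complex \<Rightarrow> complex" where
  "log_nonlin z = z * of_real (ln ((cmod z)\<^sup>2))"

text \<open>
  Equation (E) in the sense of distributions on \<open>\<real> \<times> \<real>\<^sup>d\<close>; all derivatives of \<open>u\<close> are moved
  to the test function. The integrals are iterated because for a function
  \<open>u\<close> in \<open>C(\<real>; L\<^sup>2)\<close> the values \<open>u t\<close> are only classes modulo null sets, so that joint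
  measurability of a given family of representatives is not available.
\<close>

definition satisfies_E ::
    "real \<Rightarrow> real \<Rightarrow> (real \<Rightarrow> 'a::euclidean_space \<Rightarrow> complex) \<Rightarrow> bool" where
  "satisfies_E \<omega> lam u \<longleftrightarrow>
     (\<forall>\<psi> :: real \<times> 'a \<Rightarrow> complex. test_function \<psi> \<longrightarrow>
        (LINT t|lborel. LINT x|lborel. u t x *
            (- \<i> * dir_deriv (1, 0) \<psi> (t, x)
             + (1/2) * (\<Sum>b\<in>Basis. dir_deriv (0, b) (dir_deriv (0, b) \<psi>) (t, x))))
      = (LINT t|lborel. LINT x|lborel.
            (- of_real (\<omega>\<^sup>2 * (norm x)\<^sup>2 / 2) * u t x + of_real lam * log_nonlin (u t x))
            * \<psi> (t, x)))"

text \<open>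
  Global solutions in \<open>L\<^sup>\<infinity>\<^sub>l\<^sub>o\<^sub>c(\<real>; \<Sigma>) \<inter> C(\<real>; L\<^sup>2)\<close>. The local bound in \<open>\<Sigma>\<close> is imposed at every
  time: a bound at almost every time extends to all times by continuity in \<open>L\<^sup>2\<close> and weak lower
  semicontinuity of the norm.
\<close>

definition solution_E ::
    "real \<Rightarrow> real \<Rightarrow> (real \<Rightarrow> 'a::euclidean_space \<Rightarrow> complex) \<Rightarrow> bool" where
  "solution_E \<omega> lam u \<longleftrightarrow>
     (\<forall>t. u t \<in> Sigma_space) \<and>
     (\<forall>T. \<exists>C. \<forall>t\<in>{-T..T}. Sigma_norm (u t) \<le> C) \<and>
     (\<forall>t. ((\<lambda>s. L2_norm (\<lambda>x. u s x - u t x)) \<longlongrightarrow> 0) (at t)) \<and>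
     satisfies_E \<omega> lam u"

definition solves_ivp ::
    "real \<Rightarrow> real \<Rightarrow> ('a::euclidean_space \<Rightarrow> complex) \<Rightarrow> (real \<Rightarrow> 'a \<Rightarrow> complex) \<Rightarrow> bool" where
  "solves_ivp \<omega> lam u0 u \<longleftrightarrow> solution_E \<omega> lam u \<and> (AE x in lborel. u 0 x = u0 x)"

definition standing_wave ::
    "real \<Rightarrow> ('a::euclidean_space \<Rightarrow> complex) \<Rightarrow> real \<Rightarrow> 'a \<Rightarrow> complex" where
  "standing_wave \<nu> \<phi> t x = \<phi> x * cis (\<nu> * t)"

text \<open>
  Stability of the wave \<open>standing_wave \<nu> \<phi>\<close>; its definition involves only the profile \<open>\<phi>\<close>, since
  \<open>\<nu>\<close> is absorbed by the infimum over \<open>\<theta>\<close>. As solutions of the Cauchy problem in the above class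
  are unique, the solution satisfies a property iff one exists and all of them have the property.
  The supremum is taken in \<open>[0, \<infinity>]\<close>.
\<close>

definition orbitally_stable ::
    "real \<Rightarrow> real \<Rightarrow> ('a::euclidean_space \<Rightarrow> complex) \<Rightarrow> bool" where
  "orbitally_stable \<omega> lam \<phi> \<longleftrightarrow>
     (\<forall>\<epsilon>>0. \<exists>\<eta>>0. \<forall>u0\<in>Sigma_space. Sigma_norm (\<lambda>x. u0 x - \<phi> x) < \<eta> \<longrightarrow>
        (\<exists>u. solves_ivp \<omega> lam u0 u) \<and>
        (\<forall>u. solves_ivp \<omega> lam u0 u \<longrightarrow>
           (SUP t::real. INF \<theta>::real. ennreal (Sigma_norm (\<lambda>x. u t x - cis \<theta> * \<phi> x)))
             < ennreal \<epsilon>))"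

abbreviation unstable ::
    "real \<Rightarrow> real \<Rightarrow> ('a::euclidean_space \<Rightarrow> complex) \<Rightarrow> bool" where
  "unstable \<omega> lam \<phi> \<equiv> \<not> orbitally_stable \<omega> lam \<phi>"

definition continuous_family :: "(real \<Rightarrow> 'a::euclidean_space \<Rightarrow> complex) \<Rightarrow> bool" where
  "continuous_family F \<longleftrightarrow>
     (\<forall>\<nu>. F \<nu> \<in> Sigma_space) \<and>
     (\<forall>\<nu>. ((\<lambda>\<mu>. Sigma_norm (\<lambda>x. F \<mu> x - F \<nu> x)) \<longlongrightarrow> 0) (at \<nu>))"

definition k_plus :: "real \<Rightarrow> real \<Rightarrow> real" where
  "k_plus \<omega> lam = - lam + sqrt (lam\<^sup>2 - \<omega>\<^sup>2)"

definition k_minus :: "real \<Rightarrow> real \<Rightarrow> real" where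
  "k_minus \<omega> lam = - lam - sqrt (lam\<^sup>2 - \<omega>\<^sup>2)"

definition phi :: "real \<Rightarrow> real \<Rightarrow> 'a::euclidean_space \<Rightarrow> real" where
  "phi lam k x = exp (- (real DIM('a) * k / (4 * lam))) * exp (- (k * (norm x)\<^sup>2 / 2))"

definition phi_nu :: "real \<Rightarrow> real \<Rightarrow> real \<Rightarrow> 'a::euclidean_space \<Rightarrow> real" where
  "phi_nu lam k \<nu> x = exp (- (\<nu> / (2 * lam))) * phi lam k x"

definition phi_crit :: "real \<Rightarrow> 'a::euclidean_space \<Rightarrow> real" where
  "phi_crit \<omega> x = exp (real DIM('a) / 4) * exp (- (\<omega> * (norm x)\<^sup>2 / 2))"

definition phi_crit_nu :: "real \<Rightarrow> real \<Rightarrow> 'a::euclidean_space \<Rightarrow> real" where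
  "phi_crit_nu \<omega> \<nu> x = exp (\<nu> / (2 * \<omega>)) * phi_crit \<omega> x"

end

(*
  The repulsive potential makes the equation invariant under translation along the trajectories of
  q'' = omega^2 q, up to a phase that is affine in x. Translating a Gaussian solitary wave by a small
  vector delta therefore gives an explicit solution whose centre is delta cosh(omega t), so its
  modulus separates from that of the wave exponentially fast and the L^2 distance to the orbit
  exceeds the norm of the profile, however small delta is.
*)

theory Submission
  imports Defs "HOL-Probability.Distributions"
begin

section \<open>Integration by parts against test functions\<close>

text \<open>The obstacle lies in the norm rather than in the dynamics. \<open>Sigma_norm\<close> is
  built from \<open>weak_deriv\<close>, a Hilbert choice, so not even the norm of an explicit
  Gaussian can be evaluated before weak derivatives are known to be unique almost everywhere. This
  is why smooth bumps are constructed and an L2 function orthogonal to all test functions is shown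
  to vanish. All profiles and solutions belong to one family
  \<open>gauss_packet k c q p \<theta>\<close>. On it the logarithm of the squared modulus is
  quadratic in x, so (E) becomes an identity between quadratic polynomials: it yields k^2 + 2 lam k
  + omega^2 = 0, with roots \<open>k_plus\<close> and \<open>k_minus\<close>, the amplitude
  \<open>c\<close>, and ordinary differential equations for \<open>q\<close>, \<open>p\<close>,
  \<open>\<theta>\<close>. The norm of the profile can serve as threshold because two Gaussians of
  equal L2 norm m that are far apart lie at distance close to sqrt 2 * m, whatever their
  phases.\<close>

lemma integrable_compact_support:
  fixes f :: "'a::euclidean_space \<Rightarrow> complex"
  assumes "continuous_on UNIV f" "compact K" "\<And>x. x \<notin> K \<Longrightarrow> f x = 0"
  shows "integrable lborel f"
proof -
  have "integrable lborel (\<lambda>x. indicator K x *\<^sub>R f x)"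
    using assms by (intro borel_integrable_compact) (auto intro: continuous_on_subset)
  also have "(\<lambda>x. indicator K x *\<^sub>R f x) = f"
    using assms(3) by (auto simp: indicator_def fun_eq_iff)
  finally show ?thesis .
qed

lemma lborel_integral_translate:
  fixes f :: "'a::euclidean_space \<Rightarrow> 'b::{banach, second_countable_topology}"
  assumes "f \<in> borel_measurable borel"
  shows "(LINT x|lborel. f (c + x)) = integral\<^sup>L lborel f"
proof -
  have "integral\<^sup>L (distr lborel borel ((+) c)) f = (LINT x|lborel. f (c + x))"
    by (rule integral_distr) (use assms in auto)
  then show ?thesis by (simp add: lborel_distr_plus)
qed

lemma lborel_integrable_translate:
  fixes f :: "'a::euclidean_space \<Rightarrow> 'b::{banach, second_countable_topology}"
  assumes "integrable lborel f"
  shows "integrable lborel (\<lambda>x. f (c + x))"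
proof -
  have "integrable (distr lborel borel ((+) c)) f"
    using assms by (simp add: lborel_distr_plus)
  then show ?thesis by (subst (asm) integrable_distr_eq) (use assms in auto)
qed

lemma has_derivative_zero_outside:
  assumes der: "(f has_derivative f') (at x)" and K: "closed K" "x \<notin> K"
    and zero: "\<And>y. y \<notin> K \<Longrightarrow> f y = 0"
  shows "f' = (\<lambda>h. 0)"
proof -
  have "(f has_derivative (\<lambda>h. 0)) (at x)"
    by (rule has_derivative_transform_within_open[of "\<lambda>y. 0" _ _ _ "- K"]) (use K zero in auto)
  with der show ?thesis by (rule has_derivative_unique)
qed

text \<open>The integral of a difference quotient vanishes by translation invariance.\<close>

lemma integral_directional_derivative_eq_0:
  fixes f :: "'a::euclidean_space \<Rightarrow> complex"
  assumes der: "\<And>x. (f has_derivative f' x) (at x)"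
    and cont: "continuous_on UNIV (\<lambda>x. f' x v)"
    and K: "compact K" and zero: "\<And>x. x \<notin> K \<Longrightarrow> f x = 0"
  shows "(LINT x|lborel. f' x v) = 0"
proof -
  define h where "h n = inverse (real (Suc n))" for n
  have h: "h n > 0" "h n \<le> 1" for n by (auto simp: h_def field_simps)
  have h0: "h \<longlonglongrightarrow> 0" unfolding h_def by (rule LIMSEQ_inverse_real_of_nat)
  have cf: "continuous_on UNIV f"
    using der by (meson continuous_at_imp_continuous_on has_derivative_continuous)
  have int_f: "integrable lborel f"
    by (rule integrable_compact_support[OF cf K zero])
  have zero': "f' x v = 0" if "x \<notin> K" for x
    using has_derivative_zero_outside[OF der compact_imp_closed[OF K] that zero] by simp
  have "bounded ((\<lambda>x. f' x v) ` K)"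
    by (intro compact_imp_bounded compact_continuous_image K continuous_on_subset[OF cont]) auto
  then obtain B where B: "B > 0" "\<And>x. x \<in> K \<Longrightarrow> norm (f' x v) \<le> B"
    by (auto simp: bounded_pos)
  have B': "norm (f' x v) \<le> B" for x
    using B zero'[of x] by (cases "x \<in> K") auto
  obtain R where R: "\<And>x. x \<in> K \<Longrightarrow> norm x \<le> R"
    using compact_imp_bounded[OF K] by (auto simp: bounded_iff)
  define g where "g n x = (f (h n *\<^sub>R v + x) - f x) /\<^sub>R h n" for n x
  \<comment> \<open>The mean value inequality along \<open>v\<close> bounds every difference
    quotient by the same \<open>B\<close>; this supplies the domination below.\<close>
  have line: "norm (f (s *\<^sub>R v + x) - f x) \<le> B * s" if "s > 0" for s x
  proof -
    have "norm (f (s *\<^sub>R v + x) - f (0 *\<^sub>R v + x)) \<le> B * norm (s - 0)"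
    proof (rule differentiable_bound[of UNIV "\<lambda>t. f (t *\<^sub>R v + x)" "\<lambda>t k. f' (t *\<^sub>R v + x) (k *\<^sub>R v)"])
      show "((\<lambda>t. f (t *\<^sub>R v + x)) has_derivative (\<lambda>k. f' (t *\<^sub>R v + x) (k *\<^sub>R v))) (at t within UNIV)" for t
        by (rule has_derivative_compose[OF _ der]) (auto intro!: derivative_eq_intros)
      show "onorm (\<lambda>k. f' (t *\<^sub>R v + x) (k *\<^sub>R v)) \<le> B" for t
        using B' linear_cmul[OF has_derivative_linear[OF der]]
        by (intro onorm_bound) (simp_all add: mult.commute[of B] mult_left_mono less_imp_le[OF B(1)])
    qed auto
    with that show ?thesis by simp
  qed
  have lim: "(\<lambda>n. g n x) \<longlonglongrightarrow> f' x v" for x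
  proof -
    have "((\<lambda>t. f (t *\<^sub>R v + x)) has_derivative (\<lambda>k. f' (0 *\<^sub>R v + x) (k *\<^sub>R v))) (at 0)"
      by (rule has_derivative_compose[OF _ der]) (auto intro!: derivative_eq_intros)
    then have "((\<lambda>t. norm (f (t *\<^sub>R v + x) - f x - f' x (t *\<^sub>R v)) / norm t) \<longlongrightarrow> 0) (at 0)"
      by (simp add: has_derivative_iff_norm)
    then have "(\<lambda>n. norm (f (h n *\<^sub>R v + x) - f x - f' x (h n *\<^sub>R v)) / norm (h n)) \<longlonglongrightarrow> 0"
      by (rule filterlim_compose) (use h0 h in \<open>auto simp: filterlim_at less_imp_neq[symmetric]\<close>)
    moreover have "norm (f (h n *\<^sub>R v + x) - f x - f' x (h n *\<^sub>R v)) / norm (h n) = norm (g n x - f' x v)" for n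
    proof -
      have "f (h n *\<^sub>R v + x) - f x - f' x (h n *\<^sub>R v) = h n *\<^sub>R (g n x - f' x v)"
        using linear_cmul[OF has_derivative_linear[OF der]] h(1)[of n]
        by (simp add: g_def scaleR_right_diff_distrib)
      then show ?thesis using h(1)[of n] by simp
    qed
    ultimately show ?thesis by (simp add: LIM_zero_iff tendsto_norm_zero_iff)
  qed
  have "(\<lambda>n. integral\<^sup>L lborel (g n)) \<longlonglongrightarrow> (LINT x|lborel. f' x v)"
  \<comment> \<open>Since \<open>h n \<le> 1\<close>, the supports of all the quotients
    \<open>g n\<close> lie in one ball, of radius \<open>R + norm v\<close>.\<close>
  proof (rule integral_dominated_convergence[where w="\<lambda>x. indicator (cball 0 (R + norm v)) x *\<^sub>R B"])
    show "(\<lambda>x. f' x v) \<in> borel_measurable lborel"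
      using cont by (simp add: borel_measurable_continuous_onI)
    show "g n \<in> borel_measurable lborel" for n
      unfolding g_def using borel_measurable_continuous_onI[OF cf] by simp
    show "integrable lborel (\<lambda>x::'a. indicator (cball 0 (R + norm v)) x *\<^sub>R B)"
      by (rule borel_integrable_compact) auto
    show "AE x in lborel. norm (g n x) \<le> indicator (cball 0 (R + norm v)) x *\<^sub>R B" for n
    proof (rule AE_I2)
      fix x :: 'a
      show "norm (g n x) \<le> indicator (cball 0 (R + norm v)) x *\<^sub>R B"
      proof (cases "x \<in> cball 0 (R + norm v)")
        case True
        have "norm (g n x) = norm (f (h n *\<^sub>R v + x) - f x) / h n"
          using h(1)[of n] by (simp add: g_def divide_inverse_commute)
        then show ?thesis
          using True line[OF h(1), of n x] h(1)[of n] by (simp add: divide_le_eq)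
      next
        case False
        have "x \<notin> K" using False R[of x] norm_ge_zero[of v] by auto
        moreover have "h n *\<^sub>R v + x \<notin> K"
        proof
          assume "h n *\<^sub>R v + x \<in> K"
          then have "norm (h n *\<^sub>R v + x) \<le> R" by (rule R)
          moreover have "norm x \<le> norm (h n *\<^sub>R v + x) + norm (h n *\<^sub>R v)"
            by (metis add_diff_cancel_left' norm_triangle_ineq4)
          moreover have "norm (h n *\<^sub>R v) \<le> norm v" using h[of n] by (simp add: mult_left_le_one_le)
          ultimately show False using False by auto
        qed
        ultimately show ?thesis using False zero by (simp add: g_def)
      qed
    qed
  qed (use lim in auto)
  moreover have "integral\<^sup>L lborel (g n) = 0" for n
    unfolding g_def using int_f lborel_integrable_translate[OF int_f] 
      lborel_integral_translate[of f "h n *\<^sub>R v"] by simp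
  ultimately show ?thesis by (simp add: LIMSEQ_const_iff)
qed

lemma test_functionD:
  fixes \<psi> :: "'a::euclidean_space \<Rightarrow> complex"
  assumes "test_function \<psi>"
  shows "(\<psi> has_derivative frechet_derivative \<psi> (at x)) (at x)"
    and "continuous_on UNIV \<psi>"
    and "b \<in> Basis \<Longrightarrow> continuous_on UNIV (dir_deriv b \<psi>)"
    and "compact (closure {x. \<psi> x \<noteq> 0})"
    and "x \<notin> closure {x. \<psi> x \<noteq> 0} \<Longrightarrow> \<psi> x = 0"
proof -
  have C: "Ck n \<psi>" for n using assms by (simp add: test_function_def)
  show "(\<psi> has_derivative frechet_derivative \<psi> (at x)) (at x)"
    using C[of "Suc 0"] frechet_derivative_works by auto
  show "continuous_on UNIV \<psi>" using C[of 0] by simp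
  show "b \<in> Basis \<Longrightarrow> continuous_on UNIV (dir_deriv b \<psi>)" using C[of 1] by simp
  show "compact (closure {x. \<psi> x \<noteq> 0})" using assms by (simp add: test_function_def)
  show "x \<notin> closure {x. \<psi> x \<noteq> 0} \<Longrightarrow> \<psi> x = 0" using closure_subset[of "{x. \<psi> x \<noteq> 0}"] by auto
qed

lemma dir_deriv_zero_outside_support:
  assumes "test_function \<psi>" "x \<notin> closure {x. \<psi> x \<noteq> 0}"
  shows "dir_deriv b \<psi> x = 0"
  unfolding dir_deriv_def
  using has_derivative_zero_outside[OF test_functionD(1)[OF assms(1)] closed_closure assms(2)
      test_functionD(5)[OF assms(1)]] by simp

lemma test_function_dir_deriv:
  assumes "test_function \<psi>" "b \<in> Basis"
  shows "test_function (dir_deriv b \<psi>)"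
proof -
  have "Ck n (dir_deriv b \<psi>)" for n
    using assms Ck.simps(2)[of n \<psi>] unfolding test_function_def by blast
  moreover have "closure {x. dir_deriv b \<psi> x \<noteq> 0} \<subseteq> closure {x. \<psi> x \<noteq> 0}"
    using dir_deriv_zero_outside_support[OF assms(1)] by (intro closure_minimal) auto
  then have "compact (closure {x. dir_deriv b \<psi> x \<noteq> 0})"
    using compact_Int_closed[OF test_functionD(4)[OF assms(1)] closed_closure] by (metis inf.absorb2)
  ultimately show ?thesis by (simp add: test_function_def)
qed

text \<open>The product of \<open>f\<close> and \<open>\<psi>\<close> has compact support, so its
  directional derivative integrates to zero, and the product rule splits that integral. The
  derivative \<open>f'\<close> is passed explicitly so that the closed formulas for Gaussian packets
  can be inserted.\<close>

lemma integral_by_parts_test_function: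
  fixes f :: "'a::euclidean_space \<Rightarrow> complex"
  assumes \<psi>: "test_function \<psi>" and b: "b \<in> Basis"
    and der: "\<And>x. (f has_derivative f' x) (at x)"
    and cont: "continuous_on UNIV (\<lambda>x. f' x b)"
  shows "integrable lborel (\<lambda>x. f x * dir_deriv b \<psi> x)"
    and "integrable lborel (\<lambda>x. f' x b * \<psi> x)"
    and "(LINT x|lborel. f x * dir_deriv b \<psi> x) = - (LINT x|lborel. f' x b * \<psi> x)"
proof -
  have cf: "continuous_on UNIV f"
    using der by (meson continuous_at_imp_continuous_on has_derivative_continuous)
  show 1: "integrable lborel (\<lambda>x. f x * dir_deriv b \<psi> x)"
  proof (rule integrable_compact_support[OF _ test_functionD(4)[OF \<psi>]])
    show "continuous_on UNIV (\<lambda>x. f x * dir_deriv b \<psi> x)"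
      by (intro continuous_on_mult cf test_functionD(3)[OF \<psi> b])
  qed (use dir_deriv_zero_outside_support[OF \<psi>] in simp)
  show 2: "integrable lborel (\<lambda>x. f' x b * \<psi> x)"
  proof (rule integrable_compact_support[OF _ test_functionD(4)[OF \<psi>]])
    show "continuous_on UNIV (\<lambda>x. f' x b * \<psi> x)"
      by (intro continuous_on_mult cont test_functionD(2)[OF \<psi>])
    show "f' x b * \<psi> x = 0" if "x \<notin> closure {x. \<psi> x \<noteq> 0}" for x
      by (simp only: test_functionD(5)[OF \<psi> that] mult_zero_right)
  qed
  have "(LINT x|lborel. f x * dir_deriv b \<psi> x + f' x b * \<psi> x) = 0"
    unfolding dir_deriv_def
  proof (rule integral_directional_derivative_eq_0
      [where f = "\<lambda>x. f x * \<psi> x" and v = b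
        and f' = "\<lambda>x h. f x * frechet_derivative \<psi> (at x) h + f' x h * \<psi> x"])
    show "continuous_on UNIV (\<lambda>x. f x * frechet_derivative \<psi> (at x) b + f' x b * \<psi> x)"
      using test_functionD(3)[OF \<psi> b, unfolded dir_deriv_def]
      by (intro continuous_on_add continuous_on_mult cf cont test_functionD(2)[OF \<psi>])
    show "f x * \<psi> x = 0" if "x \<notin> closure {x. \<psi> x \<noteq> 0}" for x
      by (simp only: test_functionD(5)[OF \<psi> that] mult_zero_right)
    show "((\<lambda>x. f x * \<psi> x) has_derivative
        (\<lambda>h. f x * frechet_derivative \<psi> (at x) h + f' x h * \<psi> x)) (at x)" for x
      by (rule has_derivative_mult[OF der test_functionD(1)[OF \<psi>]])
  qed (rule test_functionD(4)[OF \<psi>])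
  then show "(LINT x|lborel. f x * dir_deriv b \<psi> x) = - (LINT x|lborel. f' x b * \<psi> x)"
    using 1 2 by (simp add: eq_neg_iff_add_eq_0)
qed

section \<open>Uniqueness of weak derivatives\<close>

lemma dir_deriv_eqI: "(f has_derivative f') (at x) \<Longrightarrow> dir_deriv b f x = f' b"
  unfolding dir_deriv_def by (metis frechet_derivative_at)

lemma Ck_Suc_imp_Ck: "Ck (Suc n) f \<Longrightarrow> Ck n f"
proof (induction n arbitrary: f)
  case 0
  then show ?case
    by (simp add: continuous_at_imp_continuous_on differentiable_imp_continuous_within)
qed (simp only: Ck.simps(2), blast)

lemma Ck_const: "Ck n (\<lambda>x. c)"
proof (induction n arbitrary: c)
  case (Suc n)
  moreover have "dir_deriv b (\<lambda>x::'a. c) = (\<lambda>x. 0)" for b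
    using dir_deriv_eqI[OF has_derivative_const] by blast
  ultimately show ?case by (simp only: Ck.simps(2)) simp
qed simp

lemma Ck_add: "Ck n f \<Longrightarrow> Ck n g \<Longrightarrow> Ck n (\<lambda>x. f x + g x)"
proof (induction n arbitrary: f g)
  case (Suc n)
  have d: "(f has_derivative frechet_derivative f (at x)) (at x)"
    "(g has_derivative frechet_derivative g (at x)) (at x)" for x
    using Suc.prems by (auto simp: frechet_derivative_works[symmetric])
  have "dir_deriv b (\<lambda>x. f x + g x) = (\<lambda>x. dir_deriv b f x + dir_deriv b g x)" for b
    using dir_deriv_eqI[OF has_derivative_add[OF d]] by (auto simp: dir_deriv_def)
  then show ?case using Suc by (auto intro: differentiable_add)
qed (auto intro: continuous_intros)

lemma Ck_mult:
  fixes f g :: "'a::euclidean_space \<Rightarrow> 'b::real_normed_algebra"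
  shows "Ck n f \<Longrightarrow> Ck n g \<Longrightarrow> Ck n (\<lambda>x. f x * g x)"
proof (induction n arbitrary: f g)
  case (Suc n)
  have d: "(f has_derivative frechet_derivative f (at x)) (at x)"
    "(g has_derivative frechet_derivative g (at x)) (at x)" for x
    using Suc.prems by (auto simp: frechet_derivative_works[symmetric])
  have "dir_deriv b (\<lambda>x. f x * g x) = (\<lambda>x. f x * dir_deriv b g x + dir_deriv b f x * g x)" for b
    using dir_deriv_eqI[OF has_derivative_mult[OF d]] by (auto simp: dir_deriv_def)
  moreover have "Ck n f" "Ck n g" using Suc.prems Ck_Suc_imp_Ck by blast+
  moreover have "(\<lambda>x. f x * g x) differentiable at x" for x
    using has_derivative_mult[OF d] by (auto simp: differentiable_def)
  ultimately show ?case using Suc.prems by (auto intro!: Ck_add Suc.IH)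
qed (auto intro: continuous_intros)

lemma Ck_prod:
  fixes f :: "'i \<Rightarrow> 'a::euclidean_space \<Rightarrow> 'b::{real_normed_algebra, comm_ring_1}"
  assumes "\<And>i. i \<in> I \<Longrightarrow> Ck n (f i)"
  shows "Ck n (\<lambda>x. \<Prod>i\<in>I. f i x)"
  using assms by (induction I rule: infinite_finite_induct) (auto intro: Ck_const Ck_mult)

section \<open>Smooth bump functions supported in boxes\<close>

text \<open>The powers \<open>1 / x ^ m\<close> make the family closed under differentiation.\<close>

definition flat_exp :: "nat \<Rightarrow> real \<Rightarrow> real" where
  "flat_exp m x = (if x > 0 then exp (- (1 / x)) / x ^ m else 0)"

lemma flat_exp_tendsto_0: "(flat_exp m \<longlongrightarrow> 0) (at 0)"
proof -
  have "((\<lambda>x. inverse x ^ m / exp (inverse x)) \<longlongrightarrow> (0::real)) (at_right 0)"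
    by (rule filterlim_compose[OF tendsto_power_div_exp_0 filterlim_inverse_at_top_right])
  then have "(flat_exp m \<longlongrightarrow> 0) (at_right 0)"
    by (rule Lim_transform_eventually)
      (auto simp: flat_exp_def eventually_at_filter exp_minus field_simps)
  moreover have "(flat_exp m \<longlongrightarrow> 0) (at_left 0)"
    by (rule Lim_transform_eventually[OF tendsto_const]) (auto simp: flat_exp_def eventually_at_filter)
  ultimately show ?thesis by (simp add: filterlim_split_at_real)
qed

lemma has_real_derivative_flat_exp:
  "(flat_exp m has_real_derivative flat_exp (m + 2) x - real m * flat_exp (m + 1) x) (at x)"
proof -
  consider "x < 0" | "x = 0" | "x > 0" by linarith
  then show ?thesis
  proof cases
    case 1
    have "((\<lambda>x. 0) has_real_derivative 0) (at x)" by simp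
    then have "(flat_exp m has_real_derivative 0) (at x)"
      by (rule has_field_derivative_transform_within_open[of _ _ _ "{..<0}"])
        (use 1 in \<open>auto simp: flat_exp_def\<close>)
    with 1 show ?thesis by (simp add: flat_exp_def)
  next
    case 2
    \<comment> \<open>For nonzero \<open>h\<close> the difference quotient at 0 is exactly
      \<open>flat_exp (Suc m) h\<close>, on both sides of 0.\<close>
    have "((\<lambda>h. (flat_exp m (0 + h) - flat_exp m 0) / h) \<longlongrightarrow> 0) (at 0)"
      by (rule Lim_transform_eventually[OF flat_exp_tendsto_0[of "Suc m"]])
        (auto simp: flat_exp_def eventually_at_filter field_simps)
    with 2 show ?thesis by (simp add: DERIV_def flat_exp_def)
  next
    case 3
    have "((\<lambda>x. exp (- (1 / x)) * inverse x ^ m) has_real_derivative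
        flat_exp (m + 2) x - real m * flat_exp (m + 1) x) (at x)"
    proof -
      have "((\<lambda>x. exp (- (1 / x))) has_real_derivative exp (- (1 / x)) * inverse x ^ 2) (at x)"
        using 3 by (auto intro!: derivative_eq_intros simp: field_simps power2_eq_square)
      moreover have "((\<lambda>x. inverse x ^ m) has_real_derivative - (real m * inverse x ^ (m + 1))) (at x)"
        by (rule DERIV_cong[OF DERIV_power[OF DERIV_inverse]], use 3 in simp, cases m)
            (simp_all add: algebra_simps)
      ultimately show ?thesis
        by (rule DERIV_cong[OF DERIV_mult])
          (use 3 in \<open>simp add: flat_exp_def field_simps power_add power2_eq_square\<close>)
    qed
    then show ?thesis
      by (rule has_field_derivative_transform_within_open[of _ _ _ "{0<..}"])
        (use 3 in \<open>auto simp: flat_exp_def field_simps\<close>)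
  qed
qed

text \<open>The induction must run over all \<open>m\<close> at once, because each derivative raises
  the index by one or two. The affine argument is the one needed for the faces of a box.\<close>

lemma Ck_flat_exp:
  fixes w :: "'a::euclidean_space"
  shows "Ck n (\<lambda>x. complex_of_real (flat_exp m (x \<bullet> w + c)))"
proof (induction n arbitrary: m)
  case 0
  have "continuous_on UNIV (flat_exp m)"
    using has_real_derivative_flat_exp DERIV_isCont continuous_at_imp_continuous_on by blast
  then show ?case
    by (auto intro!: continuous_intros continuous_on_compose2[of UNIV "flat_exp m"])
next
  case (Suc n)
  let ?D = "\<lambda>x. flat_exp (m + 2) (x \<bullet> w + c) - real m * flat_exp (m + 1) (x \<bullet> w + c)"
  have d: "((\<lambda>x. complex_of_real (flat_exp m (x \<bullet> w + c))) has_derivative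
      (\<lambda>h. complex_of_real (?D x * (h \<bullet> w)))) (at x)" for x
  proof -
    have "((\<lambda>x. flat_exp m (x \<bullet> w + c)) has_derivative (\<lambda>h. ?D x * (h \<bullet> w))) (at x)"
      by (rule has_derivative_compose[OF _ has_real_derivative_flat_exp[unfolded has_field_derivative_def]])
        (auto intro!: derivative_eq_intros)
    then show ?thesis by (rule has_derivative_of_real)
  qed
  have "dir_deriv b (\<lambda>x. complex_of_real (flat_exp m (x \<bullet> w + c))) =
      (\<lambda>x. complex_of_real (b \<bullet> w) * complex_of_real (flat_exp (m + 2) (x \<bullet> w + c))
         + complex_of_real (- (b \<bullet> w) * real m) * complex_of_real (flat_exp (m + 1) (x \<bullet> w + c)))" for b
    using dir_deriv_eqI[OF d, of b] by (auto simp: algebra_simps)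
  moreover have "(\<lambda>x. complex_of_real (flat_exp m (x \<bullet> w + c))) differentiable at x" for x
    using d by (auto simp: differentiable_def)
  ultimately show ?case
    by (simp only: Ck.simps(2)) (auto simp only: intro!: Ck_add Ck_mult Ck_const Suc.IH)
qed

text \<open>Each coordinate carries one factor per face, exp(-1/(N s)) with s the distance to that
  face inside the box and N = \<open>Suc n\<close>. As N grows every factor tends to 1 inside, while
  outside some factor is 0. The arguments are spelled in the affine form of
  \<open>Ck_flat_exp\<close>.\<close>

definition box_bump :: "'a::euclidean_space \<Rightarrow> 'a \<Rightarrow> nat \<Rightarrow> 'a \<Rightarrow> complex" where
  "box_bump l u n x = (\<Prod>b\<in>Basis.
     complex_of_real (flat_exp 0 (x \<bullet> (real (Suc n) *\<^sub>R b) + (- real (Suc n) * (l \<bullet> b)))) *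
     complex_of_real (flat_exp 0 (x \<bullet> (- real (Suc n) *\<^sub>R b) + real (Suc n) * (u \<bullet> b))))"

lemma flat_exp_0_bounds: "0 \<le> flat_exp 0 x" "flat_exp 0 x \<le> 1"
  by (auto simp: flat_exp_def)

lemma box_bump_outside:
  assumes "x \<notin> box l u"
  shows "box_bump l u n x = 0"
proof -
  from assms obtain b where b: "b \<in> Basis" "x \<bullet> b \<le> l \<bullet> b \<or> u \<bullet> b \<le> x \<bullet> b"
    by (auto simp: mem_box not_less)
  moreover define N where "N = real (Suc n)"
  ultimately have "N * (x \<bullet> b) \<le> N * (l \<bullet> b) \<or> N * (u \<bullet> b) \<le> N * (x \<bullet> b)"
    by (meson mult_left_mono of_nat_0_le_iff)
  then have "flat_exp 0 (x \<bullet> (N *\<^sub>R b) + (- N * (l \<bullet> b))) = 0 \<or>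
      flat_exp 0 (x \<bullet> (- N *\<^sub>R b) + N * (u \<bullet> b)) = 0"
    by (auto simp: flat_exp_def)
  then show ?thesis unfolding box_bump_def N_def using b(1) by (intro prod_zero) auto
qed

lemma norm_box_bump_le: "norm (box_bump l u n x) \<le> indicat_real (box l u) x"
proof (cases "x \<in> box l u")
  case True
  have "norm (box_bump l u n x) \<le> 1"
    unfolding box_bump_def prod_norm[symmetric]
    by (intro prod_le_1) (auto simp: norm_mult flat_exp_0_bounds intro!: mult_le_one)
  with True show ?thesis by simp
qed (simp add: box_bump_outside)

lemma box_bump_tendsto:
  fixes x :: "'a::euclidean_space"
  shows "(\<lambda>n. box_bump l u n x) \<longlonglongrightarrow> indicator (box l u) x"
proof (cases "x \<in> box l u")
  case True
  have lim: "(\<lambda>n. complex_of_real (flat_exp 0 (real (Suc n) * d))) \<longlonglongrightarrow> of_real 1" if "d > 0" for d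
  proof (rule tendsto_of_real)
    have "(\<lambda>n. exp (- (inverse (real (Suc n)) * inverse d))) \<longlonglongrightarrow> exp (- (0 * inverse d))"
      by (intro tendsto_intros LIMSEQ_inverse_real_of_nat)
    then show "(\<lambda>n. flat_exp 0 (real (Suc n) * d)) \<longlonglongrightarrow> 1"
      using that by (simp add: flat_exp_def zero_less_mult_iff divide_inverse)
  qed
  have "(\<lambda>n. box_bump l u n x) \<longlonglongrightarrow> (\<Prod>b\<in>(Basis::'a set). of_real 1 * of_real 1)"
    unfolding box_bump_def
  proof (intro tendsto_prod tendsto_mult)
    fix b :: 'a assume b: "b \<in> Basis"
    show "(\<lambda>n. complex_of_real (flat_exp 0 (x \<bullet> (real (Suc n) *\<^sub>R b) + (- real (Suc n) * (l \<bullet> b)))))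
        \<longlonglongrightarrow> of_real 1"
      using lim[of "x \<bullet> b - l \<bullet> b"] True b by (simp add: mem_box algebra_simps)
    show "(\<lambda>n. complex_of_real (flat_exp 0 (x \<bullet> (- real (Suc n) *\<^sub>R b) + real (Suc n) * (u \<bullet> b))))
        \<longlonglongrightarrow> of_real 1"
      using lim[of "u \<bullet> b - x \<bullet> b"] True b by (simp add: mem_box algebra_simps)
  qed
  with True show ?thesis by simp
qed (simp add: box_bump_outside)

lemma test_function_box_bump: "test_function (box_bump l u n)"
proof -
  have "Ck m (box_bump l u n)" for m
    unfolding box_bump_def by (intro Ck_prod Ck_mult Ck_flat_exp)
  moreover have "closure {x. box_bump l u n x \<noteq> 0} \<subseteq> cbox l u"
    using box_bump_outside[of _ l u n] box_subset_cbox[of l u] by (intro closure_minimal) auto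
  then have "compact (closure {x. box_bump l u n x \<noteq> 0})"
    using compact_Int_closed[OF compact_cbox closed_closure] by (metis inf.absorb2)
  ultimately show ?thesis by (simp add: test_function_def)
qed

section \<open>Square integrable functions orthogonal to all test functions\<close>

lemma integrable_L2_on_box:
  fixes f :: "'a::euclidean_space \<Rightarrow> complex"
  assumes "f \<in> L2"
  shows "integrable lborel (\<lambda>x. indicator (box l u) x *\<^sub>R f x)"
proof (rule Bochner_Integration.integrable_bound[where f="\<lambda>x. indicat_real (box l u) x + (cmod (f x))\<^sup>2"])
  show "integrable lborel (\<lambda>x. indicat_real (box l u) x + (cmod (f x))\<^sup>2)"
    using assms by (auto simp: L2_def emeasure_lborel_box_eq intro!: Bochner_Integration.integrable_add integrable_real_indicator)
  show "(\<lambda>x. indicator (box l u) x *\<^sub>R f x) \<in> borel_measurable lborel"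
    using assms by (auto simp: L2_def)
  have "t \<le> 1 + t\<^sup>2" if "t \<ge> 0" for t :: real
    using zero_le_power2[of "t - 1 / 2"] by (simp add: power2_eq_square algebra_simps)
  then show "AE x in lborel. norm (indicator (box l u) x *\<^sub>R f x)
      \<le> norm (indicat_real (box l u) x + (cmod (f x))\<^sup>2)"
    by (auto simp: indicator_def)
qed

text \<open>The bumps are test functions that converge pointwise to the indicator of the box and
  stay below it, so orthogonality survives the limit by dominated convergence.\<close>

lemma integral_box_eq_0:
  fixes f :: "'a::euclidean_space \<Rightarrow> complex"
  assumes f: "f \<in> L2" and zero: "\<And>\<psi>. test_function \<psi> \<Longrightarrow> (LINT x|lborel. f x * \<psi> x) = 0"
  shows "(LINT x|lborel. indicator (box l u) x *\<^sub>R f x) = 0"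
proof -
  have "(\<lambda>n. LINT x|lborel. f x * box_bump l u n x) \<longlonglongrightarrow> (LINT x|lborel. indicator (box l u) x *\<^sub>R f x)"
  proof (rule integral_dominated_convergence[where w="\<lambda>x. norm (indicat_real (box l u) x *\<^sub>R f x)"])
    show "(\<lambda>x. indicat_real (box l u) x *\<^sub>R f x) \<in> borel_measurable lborel"
      using f by (auto simp: L2_def)
    have "box_bump l u n \<in> borel_measurable borel" for n
      by (intro borel_measurable_continuous_onI test_functionD test_function_box_bump)
    then show "(\<lambda>x. f x * box_bump l u n x) \<in> borel_measurable lborel" for n
      using f by (auto simp: L2_def)
    show "integrable lborel (\<lambda>x. norm (indicat_real (box l u) x *\<^sub>R f x))"
      by (intro integrable_norm integrable_L2_on_box f)
    show "AE x in lborel. (\<lambda>n. f x * box_bump l u n x) \<longlonglongrightarrow> indicat_real (box l u) x *\<^sub>R f x"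
    proof (rule AE_I2)
      fix x
      have "(\<lambda>n. f x * box_bump l u n x) \<longlonglongrightarrow> f x * indicator (box l u) x"
        by (intro tendsto_intros box_bump_tendsto)
      then show "(\<lambda>n. f x * box_bump l u n x) \<longlonglongrightarrow> indicat_real (box l u) x *\<^sub>R f x"
        by (cases "x \<in> box l u") auto
    qed
    show "AE x in lborel. norm (f x * box_bump l u n x) \<le> norm (indicat_real (box l u) x *\<^sub>R f x)" for n
      using norm_box_bump_le[of l u n] by (simp add: norm_mult mult.commute[of "cmod (f _)"] mult_right_mono)
  qed
  then show ?thesis
    by (simp add: zero test_function_box_bump LIMSEQ_const_iff)
qed

text \<open>Open boxes generate the Borel sets and are stable under intersection, so a Dynkin
  argument carries vanishing integrals from boxes to all Borel sets, and a density whose integrals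
  all vanish is zero almost everywhere. An L2 function may fail to be integrable, hence the
  truncation to the boxes \<open>?B n\<close>, which exhaust the space.\<close>

lemma L2_eq_0_AE:
  fixes f :: "'a::euclidean_space \<Rightarrow> complex"
  assumes f: "f \<in> L2" and zero: "\<And>\<psi>. test_function \<psi> \<Longrightarrow> (LINT x|lborel. f x * \<psi> x) = 0"
  shows "AE x in lborel. f x = 0"
proof -
  let ?B = "\<lambda>n::nat. box (- (real n *\<^sub>R One)) (real n *\<^sub>R One) :: 'a set"
  have "AE x in lborel. indicator (?B n) x *\<^sub>R f x = 0" for n
  proof (rule sigma_finite_measure.density_zero[OF sigma_finite_lborel])
    let ?g = "\<lambda>x. indicator (?B n) x *\<^sub>R f x"
    show int: "integrable lborel ?g" by (rule integrable_L2_on_box[OF f])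
    have meas: "X \<in> sets lborel" if "X \<in> sigma_sets UNIV (range (\<lambda>(a, b). box a b))" for X :: "'a set"
      using that by (simp add: borel_eq_box)
    have si: "set_integrable lborel X ?g" if "X \<in> sets lborel" for X
      unfolding set_integrable_def using that int by (rule integrable_mult_indicator)
    fix A :: "'a set" assume "A \<in> sets lborel"
    then have A: "A \<in> sigma_sets UNIV (range (\<lambda>(a, b). box a b))"
      by (simp add: borel_eq_box)
    have stable: "Int_stable (range (\<lambda>(a, b). box a b :: 'a set))"
      by (auto simp: Int_stable_def box_Int_box)
    have closed: "range (\<lambda>(a, b). box a b :: 'a set) \<subseteq> Pow UNIV" by auto
    from stable closed A show "set_lebesgue_integral lborel A ?g = 0"
    proof (induction rule: sigma_sets_induct_disjoint)
      case (basic X)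
      then obtain a b where X: "X = box a b" by auto
      have "(\<lambda>x. indicator X x *\<^sub>R ?g x) = (\<lambda>x. indicator (X \<inter> ?B n) x *\<^sub>R f x)"
        by (auto simp: indicator_def)
      then show ?case
        unfolding set_lebesgue_integral_def
        by (simp only: X box_Int_box integral_box_eq_0[OF f zero])
    next
      \<comment> \<open>The integral of \<open>?g\<close> over the whole space vanishes as well,
        being the integral of \<open>f\<close> over \<open>?B n\<close>.\<close>
      case (compl X)
      have "set_lebesgue_integral lborel (UNIV - X) ?g = integral\<^sup>L lborel ?g - set_lebesgue_integral lborel X ?g"
        unfolding set_lebesgue_integral_def
        by (subst Bochner_Integration.integral_diff[symmetric, OF int si[OF meas[OF compl(1)], unfolded set_integrable_def]])
          (auto intro!: Bochner_Integration.integral_cong simp: indicator_def)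
      then show ?case using compl integral_box_eq_0[OF f zero] by simp
    next
      case (union F)
      have F: "F i \<in> sets lborel" for i using union(2) meas by blast
      then have "(LINT x:(\<Union>i. F i)|lborel. ?g x) = (\<Sum>i. (LINT x:(F i)|lborel. ?g x))"
        using union(1) by (intro lebesgue_integral_countable_add si)
          (auto simp: disjoint_family_on_def)
      then show ?case by (simp add: union)
    qed (auto simp: set_lebesgue_integral_def)
  qed
  then have "AE x in lborel. \<forall>n. indicator (?B n) x *\<^sub>R f x = 0"
    unfolding AE_all_countable by blast
  then show ?thesis
  proof (rule AE_mp, intro AE_I2 impI)
    fix x :: 'a
    have "x \<in> (\<Union>n. ?B n)" by (simp add: UN_box_eq_UNIV)
    moreover assume "\<forall>n. indicator (?B n) x *\<^sub>R f x = 0"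
    ultimately show "f x = 0" by (auto simp: indicator_def split: if_splits)
  qed
qed

section \<open>Functions with Gaussian decay\<close>

lemma L2_diff:
  assumes "f \<in> L2" "g \<in> L2"
  shows "(\<lambda>x. f x - g x) \<in> L2"
proof -
  have meas: "f \<in> borel_measurable borel" "g \<in> borel_measurable borel"
    and int: "integrable lborel (\<lambda>x. (cmod (f x))\<^sup>2)" "integrable lborel (\<lambda>x. (cmod (g x))\<^sup>2)"
    using assms by (simp_all add: L2_def)
  have sq: "(cmod (a - b))\<^sup>2 \<le> 2 * (cmod a)\<^sup>2 + 2 * (cmod b)\<^sup>2" for a b
  proof -
    have "(cmod (a - b))\<^sup>2 \<le> (cmod a + cmod b)\<^sup>2"
      by (intro power_mono norm_triangle_ineq4 norm_ge_zero)
    also have "\<dots> \<le> (cmod a + cmod b)\<^sup>2 + (cmod a - cmod b)\<^sup>2" by simp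
    also have "\<dots> = 2 * (cmod a)\<^sup>2 + 2 * (cmod b)\<^sup>2" by algebra
    finally show ?thesis .
  qed
  have "integrable lborel (\<lambda>x. (cmod (f x - g x))\<^sup>2)"
  proof (rule Bochner_Integration.integrable_bound)
    show "integrable lborel (\<lambda>x. 2 * (cmod (f x))\<^sup>2 + 2 * (cmod (g x))\<^sup>2)"
      by (intro Bochner_Integration.integrable_add integrable_mult_right int)
    show "(\<lambda>x. (cmod (f x - g x))\<^sup>2) \<in> borel_measurable lborel"
      using meas by simp
    show "AE x in lborel. norm ((cmod (f x - g x))\<^sup>2) \<le> norm (2 * (cmod (f x))\<^sup>2 + 2 * (cmod (g x))\<^sup>2)"
      by (intro AE_I2) (simp add: sq)
  qed
  then show ?thesis using meas by (simp add: L2_def)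
qed

lemma integrable_L2_mult_test_function:
  assumes f: "f \<in> L2" and \<psi>: "test_function \<psi>"
  shows "integrable lborel (\<lambda>x. f x * \<psi> x)"
proof (rule Bochner_Integration.integrable_bound[where f = "\<lambda>x. (cmod (f x))\<^sup>2 + cmod (\<psi> x * \<psi> x)"])
  have "integrable lborel (\<lambda>x. \<psi> x * \<psi> x)"
  proof (rule integrable_compact_support[OF _ test_functionD(4)[OF \<psi>]])
    show "continuous_on UNIV (\<lambda>x. \<psi> x * \<psi> x)"
      by (intro continuous_on_mult test_functionD(2)[OF \<psi>])
    show "\<psi> x * \<psi> x = 0" if "x \<notin> closure {x. \<psi> x \<noteq> 0}" for x
      by (simp only: test_functionD(5)[OF \<psi> that] mult_zero_right)
  qed
  then show "integrable lborel (\<lambda>x. (cmod (f x))\<^sup>2 + cmod (\<psi> x * \<psi> x))"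
    using f by (auto simp: L2_def intro!: Bochner_Integration.integrable_add)
  have "\<psi> \<in> borel_measurable borel"
    by (intro borel_measurable_continuous_onI test_functionD(2)[OF \<psi>])
  then show "(\<lambda>x. f x * \<psi> x) \<in> borel_measurable lborel"
    using f by (auto simp: L2_def)
  have "r * s \<le> r\<^sup>2 + s * s" if "r \<ge> 0" "s \<ge> 0" for r s :: real
    using sum_squares_bound[of r s] mult_nonneg_nonneg[OF that] unfolding power2_eq_square by linarith
  then show "AE x in lborel. norm (f x * \<psi> x) \<le> norm ((cmod (f x))\<^sup>2 + cmod (\<psi> x * \<psi> x))"
    by (auto simp: norm_mult)
qed

text \<open>Of the chosen \<open>weak_deriv b f\<close> only the specification is available. Its
  difference with any explicit weak derivative is orthogonal to all test functions, so the explicit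
  one may replace it under every integral.\<close>

lemma weak_deriv_AE_eq:
  assumes g: "g \<in> L2" "is_weak_deriv b f g"
  shows "weak_deriv b f \<in> L2" and "AE x in lborel. weak_deriv b f x = g x"
proof -
  have w: "weak_deriv b f \<in> L2 \<and> is_weak_deriv b f (weak_deriv b f)"
    unfolding weak_deriv_def by (rule someI[where x = g]) (use g in simp)
  then show "weak_deriv b f \<in> L2" by simp
  have "AE x in lborel. weak_deriv b f x - g x = 0"
  proof (rule L2_eq_0_AE)
    show "(\<lambda>x. weak_deriv b f x - g x) \<in> L2" using w g by (intro L2_diff) auto
    fix \<psi> :: "'a \<Rightarrow> complex" assume \<psi>: "test_function \<psi>"
    have "(LINT x|lborel. weak_deriv b f x * \<psi> x) = (LINT x|lborel. g x * \<psi> x)"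
      using w g \<psi> unfolding is_weak_deriv_def by (metis neg_equal_iff_equal)
    then show "(LINT x|lborel. (weak_deriv b f x - g x) * \<psi> x) = 0"
      using w g \<psi> by (simp add: left_diff_distrib integrable_L2_mult_test_function)
  qed
  then show "AE x in lborel. weak_deriv b f x = g x" by simp
qed

lemma L2_norm_weak_deriv:
  assumes "g \<in> L2" "is_weak_deriv b f g"
  shows "(L2_norm (weak_deriv b f))\<^sup>2 = (LINT x|lborel. (cmod (g x))\<^sup>2)"
proof -
  have "(LINT x|lborel. (cmod (weak_deriv b f x))\<^sup>2) = (LINT x|lborel. (cmod (g x))\<^sup>2)"
    using weak_deriv_AE_eq[OF assms] assms by (intro integral_cong_AE) (auto simp: L2_def)
  then show ?thesis by (simp add: L2_norm_def)
qed

lemma L2_norm_le_Sigma_norm: "L2_norm f \<le> Sigma_norm f"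
proof -
  have "L2_norm f = sqrt ((L2_norm f)\<^sup>2)" by (simp add: L2_norm_def)
  also have "\<dots> \<le> Sigma_norm f"
    unfolding Sigma_norm_def
    by (intro real_sqrt_le_mono) (simp add: sum_nonneg add_nonneg_nonneg add.assoc)
  finally show ?thesis .
qed

section \<open>Gaussian domination in the norm of Sigma\<close>

lemma integrable_gaussian:
  assumes "K > 0"
  shows "integrable lborel (\<lambda>x::'a::euclidean_space. exp (- K * (norm x)\<^sup>2))"
proof -
  \<comment> \<open>This standard deviation makes 1/(2 sigma^2) equal to \<open>K\<close>; in higher
    dimension the Gaussian is a product over the coordinates.\<close>
  define \<sigma> where "\<sigma> = sqrt (1 / (2 * K))"
  have \<sigma>: "\<sigma> > 0" "\<sigma>\<^sup>2 = 1 / (2 * K)" using assms by (auto simp: \<sigma>_def)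
  have "exp (- K * t\<^sup>2) = sqrt (2 * pi * \<sigma>\<^sup>2) * normal_density 0 \<sigma> t" for t
    using assms by (simp add: normal_density_def \<sigma> real_sqrt_divide)
  then have int1: "integrable lborel (\<lambda>t::real. exp (- K * t\<^sup>2))"
    using \<sigma> by simp
  have prod: "exp (- K * (norm x)\<^sup>2) = (\<Prod>b\<in>Basis. exp (- K * (x \<bullet> b)\<^sup>2))" for x :: 'a
    unfolding exp_sum[OF finite_Basis, symmetric] sum_distrib_left[symmetric]
      power2_norm_eq_inner by (subst euclidean_inner[of x x]) (simp add: power2_eq_square)
  have "(\<integral>\<^sup>+x. ennreal (exp (- K * (norm x)\<^sup>2)) \<partial>(lborel :: 'a measure))
      = (\<integral>\<^sup>+x. (\<Prod>b\<in>Basis. ennreal (exp (- K * (x \<bullet> b)\<^sup>2))) \<partial>(lborel :: 'a measure))"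
    by (simp only: prod prod_ennreal exp_ge_zero)
  also have "\<dots> = (\<Prod>b\<in>(Basis::'a set). \<integral>\<^sup>+t. ennreal (exp (- K * t\<^sup>2)) \<partial>lborel)"
    by (subst nn_integral_lborel_prod[where f = "\<lambda>b t. ennreal (exp (- K * t\<^sup>2))"]) auto
  also have "\<dots> < \<infinity>"
    using int1 by (subst nn_integral_eq_integral) (auto simp: ennreal_power power_less_top_ennreal)
  finally show ?thesis by (intro integrableI_bounded) auto
qed

text \<open>By t \<le> exp t at t = K |x|^2, one of the two exponential factors absorbs the weight
  and the other remains as an integrable bound.\<close>

lemma norm_sq_gaussian_le:
  assumes "K > 0"
  shows "(norm x)\<^sup>2 * (exp (- K * (norm x)\<^sup>2))\<^sup>2 \<le> (1 / K) * exp (- K * (norm x)\<^sup>2)"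
proof -
  have "K * (norm x)\<^sup>2 \<le> exp (K * (norm x)\<^sup>2)"
    using exp_ge_add_one_self[of "K * (norm x)\<^sup>2"] by linarith
  then have "(K * (norm x)\<^sup>2) * exp (- K * (norm x)\<^sup>2) \<le> exp (K * (norm x)\<^sup>2) * exp (- K * (norm x)\<^sup>2)"
    by (rule mult_right_mono) simp
  also have "\<dots> = 1" by (simp add: exp_add[symmetric])
  finally have "(norm x)\<^sup>2 * exp (- K * (norm x)\<^sup>2) \<le> 1 / K"
    using assms by (simp add: field_simps)
  from mult_right_mono[OF this, of "exp (- K * (norm x)\<^sup>2)"] show ?thesis
    by (simp add: power2_eq_square mult.assoc)
qed

lemma gaussian_bound_squares:
  assumes K: "K > 0" and bound: "cmod z \<le> C * exp (- K * (norm x)\<^sup>2)"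
  shows "(cmod z)\<^sup>2 \<le> C\<^sup>2 * exp (- K * (norm x)\<^sup>2)"
    and "(norm x)\<^sup>2 * (cmod z)\<^sup>2 \<le> (C\<^sup>2 / K) * exp (- K * (norm x)\<^sup>2)"
proof -
  have sq: "(cmod z)\<^sup>2 \<le> C\<^sup>2 * (exp (- K * (norm x)\<^sup>2))\<^sup>2"
    using power_mono[OF bound norm_ge_zero, of 2] by (simp add: power_mult_distrib)
  also have "\<dots> \<le> C\<^sup>2 * exp (- K * (norm x)\<^sup>2)"
    using K by (intro mult_left_mono) (auto simp: power2_eq_square)
  finally show "(cmod z)\<^sup>2 \<le> C\<^sup>2 * exp (- K * (norm x)\<^sup>2)" .
  have "(norm x)\<^sup>2 * (cmod z)\<^sup>2 \<le> C\<^sup>2 * ((norm x)\<^sup>2 * (exp (- K * (norm x)\<^sup>2))\<^sup>2)"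
    using mult_left_mono[OF sq, of "(norm x)\<^sup>2"] by (simp add: mult_ac)
  also have "\<dots> \<le> C\<^sup>2 * ((1 / K) * exp (- K * (norm x)\<^sup>2))"
    by (intro mult_left_mono norm_sq_gaussian_le K) simp
  finally show "(norm x)\<^sup>2 * (cmod z)\<^sup>2 \<le> (C\<^sup>2 / K) * exp (- K * (norm x)\<^sup>2)" by simp
qed

lemma L2_gaussian_bound:
  fixes f :: "'a::euclidean_space \<Rightarrow> complex"
  assumes K: "K > 0" and cont: "continuous_on UNIV f"
    and bound: "\<And>x. cmod (f x) \<le> C * exp (- K * (norm x)\<^sup>2)"
  shows "f \<in> L2" and "(\<lambda>x. of_real (norm x) * f x) \<in> L2"
proof -
  have [measurable]: "f \<in> borel_measurable borel"
    by (rule borel_measurable_continuous_onI[OF cont])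
  have "integrable lborel (\<lambda>x. (cmod (f x))\<^sup>2)"
    by (rule Bochner_Integration.integrable_bound[where f = "\<lambda>x. C\<^sup>2 * exp (- K * (norm x)\<^sup>2)"])
      (use integrable_gaussian[OF K] gaussian_bound_squares(1)[OF K bound] in auto)
  then show "f \<in> L2" by (auto simp: L2_def)
  have "integrable lborel (\<lambda>x. (norm x)\<^sup>2 * (cmod (f x))\<^sup>2)"
    by (rule Bochner_Integration.integrable_bound[where f = "\<lambda>x. (C\<^sup>2 / K) * exp (- K * (norm x)\<^sup>2)"])
      (use K integrable_gaussian[OF K] gaussian_bound_squares(2)[OF K bound] in auto)
  then show "(\<lambda>x. of_real (norm x) * f x) \<in> L2"
    by (auto simp: L2_def norm_mult power_mult_distrib)
qed

text \<open>This is where the Hilbert choice disappears: classical partial derivatives are weak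
  derivatives by integration by parts, and by uniqueness they compute the gradient term of the
  norm.\<close>

lemma Sigma_gaussian_bound:
  fixes f :: "'a::euclidean_space \<Rightarrow> complex"
  assumes K: "K > 0"
    and der: "\<And>x. (f has_derivative f' x) (at x)"
    and cont: "\<And>b. b \<in> Basis \<Longrightarrow> continuous_on UNIV (\<lambda>x. f' x b)"
    and bound: "\<And>x. cmod (f x) \<le> C * exp (- K * (norm x)\<^sup>2)"
    and bound': "\<And>x b. b \<in> Basis \<Longrightarrow> cmod (f' x b) \<le> C * exp (- K * (norm x)\<^sup>2)"
  shows "f \<in> Sigma_space"
    and "Sigma_norm f = sqrt ((LINT x|lborel. (cmod (f x))\<^sup>2)
      + (\<Sum>b\<in>Basis. LINT x|lborel. (cmod (f' x b))\<^sup>2)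
      + (LINT x|lborel. (norm x)\<^sup>2 * (cmod (f x))\<^sup>2))"
proof -
  have cf: "continuous_on UNIV f"
    using der by (meson continuous_at_imp_continuous_on has_derivative_continuous)
  have weak: "is_weak_deriv b f (\<lambda>x. f' x b)" if "b \<in> Basis" for b
    unfolding is_weak_deriv_def
    using integral_by_parts_test_function(3)[OF _ that der cont[OF that]] by simp
  have L2': "(\<lambda>x. f' x b) \<in> L2" if "b \<in> Basis" for b
    by (rule L2_gaussian_bound(1)[OF K cont[OF that] bound'[OF that]])
  show "f \<in> Sigma_space"
    using L2_gaussian_bound[OF K cf bound] weak L2' unfolding Sigma_space_def H1_def by blast
  have "(\<Sum>b\<in>Basis. (L2_norm (weak_deriv b f))\<^sup>2) = (\<Sum>b\<in>Basis. LINT x|lborel. (cmod (f' x b))\<^sup>2)"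
    by (intro sum.cong refl L2_norm_weak_deriv L2' weak)
  then show "Sigma_norm f = sqrt ((LINT x|lborel. (cmod (f x))\<^sup>2)
      + (\<Sum>b\<in>Basis. LINT x|lborel. (cmod (f' x b))\<^sup>2)
      + (LINT x|lborel. (norm x)\<^sup>2 * (cmod (f x))\<^sup>2))"
    by (simp add: Sigma_norm_def L2_norm_def)
qed

text \<open>One Gaussian bound, uniform in \<open>n\<close>, dominates all the integrals in
  \<open>Sigma_gaussian_bound\<close>, so pointwise convergence of the functions and of their
  partial derivatives is enough. Continuous parameters are handled later by the sequential criterion
  for limits.\<close>

lemma tendsto_Sigma_norm_gaussian_bound:
  fixes f :: "nat \<Rightarrow> 'a::euclidean_space \<Rightarrow> complex"
  assumes K: "K > 0"
    and der: "\<And>n x. (f n has_derivative f' n x) (at x)" "\<And>x. (g has_derivative g' x) (at x)"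
    and cont: "\<And>n b. b \<in> Basis \<Longrightarrow> continuous_on UNIV (\<lambda>x. f' n x b)"
      "\<And>b. b \<in> Basis \<Longrightarrow> continuous_on UNIV (\<lambda>x. g' x b)"
    and bound: "\<And>n x. cmod (f n x) \<le> C * exp (- K * (norm x)\<^sup>2)"
      "\<And>x. cmod (g x) \<le> C * exp (- K * (norm x)\<^sup>2)"
    and bound': "\<And>n x b. b \<in> Basis \<Longrightarrow> cmod (f' n x b) \<le> C * exp (- K * (norm x)\<^sup>2)"
      "\<And>x b. b \<in> Basis \<Longrightarrow> cmod (g' x b) \<le> C * exp (- K * (norm x)\<^sup>2)"
    and lim: "\<And>x. (\<lambda>n. f n x) \<longlonglongrightarrow> g x"
      "\<And>x b. b \<in> Basis \<Longrightarrow> (\<lambda>n. f' n x b) \<longlonglongrightarrow> g' x b"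
  shows "(\<lambda>n. Sigma_norm (f n)) \<longlonglongrightarrow> Sigma_norm g"
proof -
  have cf: "continuous_on UNIV (f n)" for n
    using der(1) by (meson continuous_at_imp_continuous_on has_derivative_continuous)
  have cg: "continuous_on UNIV g"
    using der(2) by (meson continuous_at_imp_continuous_on has_derivative_continuous)
  note meas = borel_measurable_continuous_onI[OF cf] borel_measurable_continuous_onI[OF cg]
  have dct: "(\<lambda>n. LINT x|lborel. (cmod (h n x))\<^sup>2) \<longlonglongrightarrow> (LINT x|lborel. (cmod (l x))\<^sup>2)"
    if "\<And>n. continuous_on UNIV (h n)" "continuous_on UNIV l"
      "\<And>n x. cmod (h n x) \<le> C * exp (- K * (norm x)\<^sup>2)" "\<And>x. (\<lambda>n. h n x) \<longlonglongrightarrow> l x"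
    for h and l :: "'a \<Rightarrow> complex"
  proof (rule integral_dominated_convergence[where w = "\<lambda>x. C\<^sup>2 * exp (- K * (norm x)\<^sup>2)"])
    show "AE x in lborel. (\<lambda>n. (cmod (h n x))\<^sup>2) \<longlonglongrightarrow> (cmod (l x))\<^sup>2"
      by (intro AE_I2 tendsto_intros that)
    show "AE x in lborel. norm ((cmod (h n x))\<^sup>2) \<le> C\<^sup>2 * exp (- K * (norm x)\<^sup>2)" for n
      using gaussian_bound_squares(1)[OF K that(3)] by auto
  qed (use integrable_gaussian[OF K] borel_measurable_continuous_onI[OF that(1)]
        borel_measurable_continuous_onI[OF that(2)] in auto)
  have "(\<lambda>n. LINT x|lborel. (norm x)\<^sup>2 * (cmod (f n x))\<^sup>2) \<longlonglongrightarrow> (LINT x|lborel. (norm x)\<^sup>2 * (cmod (g x))\<^sup>2)"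
  proof (rule integral_dominated_convergence[where w = "\<lambda>x. (C\<^sup>2 / K) * exp (- K * (norm x)\<^sup>2)"])
    show "AE x in lborel. (\<lambda>n. (norm x)\<^sup>2 * (cmod (f n x))\<^sup>2) \<longlonglongrightarrow> (norm x)\<^sup>2 * (cmod (g x))\<^sup>2"
      by (intro AE_I2 tendsto_intros lim)
    show "AE x in lborel. norm ((norm x)\<^sup>2 * (cmod (f n x))\<^sup>2) \<le> (C\<^sup>2 / K) * exp (- K * (norm x)\<^sup>2)" for n
      using gaussian_bound_squares(2)[OF K bound(1)] by auto
  qed (use K integrable_gaussian[OF K] meas in auto)
  moreover have "Sigma_norm (f n) = sqrt ((LINT x|lborel. (cmod (f n x))\<^sup>2)
      + (\<Sum>b\<in>Basis. LINT x|lborel. (cmod (f' n x b))\<^sup>2)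
      + (LINT x|lborel. (norm x)\<^sup>2 * (cmod (f n x))\<^sup>2))" for n
    by (intro Sigma_gaussian_bound(2)[OF K, where C = C] der cont bound bound')
  moreover have "Sigma_norm g = sqrt ((LINT x|lborel. (cmod (g x))\<^sup>2)
      + (\<Sum>b\<in>Basis. LINT x|lborel. (cmod (g' x b))\<^sup>2)
      + (LINT x|lborel. (norm x)\<^sup>2 * (cmod (g x))\<^sup>2))"
    by (intro Sigma_gaussian_bound(2)[OF K, where C = C] der cont bound bound')
  ultimately show ?thesis
    by (simp only:) (intro tendsto_intros dct cf cg cont bound bound' lim)
qed

text \<open>Not a matter of unfolding: the weak derivative of the zero function is itself a chosen
  representative, known only up to a null set.\<close>

lemma Sigma_norm_zero: "Sigma_norm (\<lambda>x::'a::euclidean_space. 0) = 0"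
  by (subst Sigma_gaussian_bound(2)[where f' = "\<lambda>x h. 0" and C = 0 and K = 1]) auto

section \<open>Gaussian wave packets\<close>

lemma has_derivative_exp_Complex:
  assumes "(A has_derivative A') (at x)" "(B has_derivative B') (at x)"
  shows "((\<lambda>x. exp (Complex (A x) (B x))) has_derivative
    (\<lambda>h. exp (Complex (A x) (B x)) * Complex (A' h) (B' h))) (at x)"
proof -
  have "((\<lambda>x. complex_of_real (A x) + \<i> * complex_of_real (B x)) has_derivative
      (\<lambda>h. complex_of_real (A' h) + \<i> * complex_of_real (B' h))) (at x)"
    by (intro has_derivative_add has_derivative_mult_right has_derivative_of_real assms)
  from has_derivative_compose[OF this DERIV_exp[unfolded has_field_derivative_def]]
  show ?thesis by (simp add: Complex_eq)
qed

text \<open>A Gaussian with log-amplitude \<open>c\<close>, centre \<open>q\<close> and momentum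
  \<open>p\<close>. Keeping everything in one complex exponential lets the modulus and the
  logarithmic derivatives be read off from the exponent.\<close>

definition gauss_packet ::
    "real \<Rightarrow> real \<Rightarrow> 'a::euclidean_space \<Rightarrow> 'a \<Rightarrow> real \<Rightarrow> 'a \<Rightarrow> complex" where
  "gauss_packet k c q p \<theta> x = exp (Complex (c - k / 2 * ((x - q) \<bullet> (x - q))) (p \<bullet> x + \<theta>))"

lemma cmod_gauss_packet: "cmod (gauss_packet k c q p \<theta> x) = exp (c - k / 2 * ((x - q) \<bullet> (x - q)))"
  by (simp add: gauss_packet_def norm_exp_eq_Re)

lemma has_derivative_gauss_packet:
  "(gauss_packet k c q p \<theta> has_derivative
    (\<lambda>h. gauss_packet k c q p \<theta> x * Complex (- k * ((x - q) \<bullet> h)) (p \<bullet> h))) (at x)"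
  unfolding gauss_packet_def
  by (rule has_derivative_exp_Complex)
    (auto intro!: derivative_eq_intros simp: inner_commute algebra_simps)

lemma continuous_on_gauss_packet: "continuous_on A (gauss_packet k c q p \<theta>)"
  using has_derivative_gauss_packet by (meson continuous_at_imp_continuous_on has_derivative_continuous)

lemma continuous_on_gauss_packet_deriv:
  "continuous_on A (\<lambda>x. gauss_packet k c q p \<theta> x * Complex (- k * ((x - q) \<bullet> h)) (p \<bullet> h))"
  unfolding Complex_eq by (intro continuous_intros continuous_on_gauss_packet)

text \<open>The exponential pays for moving the centre from \<open>q\<close> to the origin. The
  second factor pays for the affine factor in the derivative; its 8 comes from k r^2 \<le> 8 exp(k
  r^2 / 8).\<close>

definition packet_const :: "real \<Rightarrow> real \<Rightarrow> real" where
  "packet_const k M = exp (M + k / 2 * M\<^sup>2) * (8 + k + k * \<bar>M\<bar> + \<bar>M\<bar>)"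

text \<open>Recentring at the origin halves the decay rate from k/2 to k/4, and absorbing the affine
  factor of the derivative halves it again to k/8. The bound depends on the parameters only through
  \<open>M\<close>, which makes it uniform along convergent or compact sets of parameters.\<close>

lemma gauss_packet_bounds:
  fixes q p x :: "'a::euclidean_space"
  assumes k: "k > 0" and M: "\<bar>c\<bar> \<le> M" "norm q \<le> M" "norm p \<le> M"
  shows "cmod (gauss_packet k c q p \<theta> x) \<le> packet_const k M * exp (- (k / 8) * (norm x)\<^sup>2)"
    and "b \<in> Basis \<Longrightarrow> cmod (gauss_packet k c q p \<theta> x * Complex (- k * ((x - q) \<bullet> b)) (p \<bullet> b))
        \<le> packet_const k M * exp (- (k / 8) * (norm x)\<^sup>2)"
proof -
  define C0 where "C0 = exp (M + k / 2 * M\<^sup>2)"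
  define D where "D = 8 + k + k * \<bar>M\<bar> + \<bar>M\<bar>"
  have kM: "0 \<le> k * \<bar>M\<bar>" using k by simp
  have D: "D \<ge> 1" "C0 > 0" using k kM unfolding D_def C0_def by (linarith, simp)
  have 1: "cmod (gauss_packet k c q p \<theta> x) \<le> C0 * exp (- (k / 4) * (norm x)\<^sup>2)"
  proof -
    \<comment> \<open>The right side minus the left side is |x - 2q|^2.\<close>
    have "(norm x)\<^sup>2 \<le> 2 * ((x - q) \<bullet> (x - q)) + 2 * (norm q)\<^sup>2"
      using inner_ge_zero[of "x - 2 *\<^sub>R q"]
      by (simp add: power2_norm_eq_inner inner_diff inner_commute algebra_simps)
    moreover have "(norm q)\<^sup>2 \<le> M\<^sup>2" using M by (intro power_mono) auto
    ultimately have "(norm x)\<^sup>2 / 2 - M\<^sup>2 \<le> (x - q) \<bullet> (x - q)" by linarith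
    from mult_left_mono[OF this, of "k / 2"] k
    have "k / 4 * (norm x)\<^sup>2 - k / 2 * M\<^sup>2 \<le> k / 2 * ((x - q) \<bullet> (x - q))"
      by (simp add: algebra_simps)
    then have "c - k / 2 * ((x - q) \<bullet> (x - q)) \<le> (M + k / 2 * M\<^sup>2) + (- (k / 4) * (norm x)\<^sup>2)"
      using M(1) by linarith
    then show ?thesis
      unfolding cmod_gauss_packet C0_def exp_add[symmetric] by simp
  qed
  have exp4: "exp (- (k / 4) * (norm x)\<^sup>2) = exp (- (k / 8) * (norm x)\<^sup>2) * exp (- (k / 8) * (norm x)\<^sup>2)"
    by (simp add: exp_add[symmetric])
  have 2: "cmod (Complex (- k * ((x - q) \<bullet> b)) (p \<bullet> b)) * exp (- (k / 8) * (norm x)\<^sup>2) \<le> D"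
    if "b \<in> Basis" for b
  proof -
    have "cmod (Complex (- k * ((x - q) \<bullet> b)) (p \<bullet> b)) \<le> \<bar>k * ((x - q) \<bullet> b)\<bar> + \<bar>p \<bullet> b\<bar>"
      using cmod_le[of "Complex (- k * ((x - q) \<bullet> b)) (p \<bullet> b)"] by simp
    also have "\<bar>k * ((x - q) \<bullet> b)\<bar> \<le> k * (norm x + M)"
    proof -
      have "\<bar>(x - q) \<bullet> b\<bar> \<le> norm (x - q)" by (rule Basis_le_norm[OF that])
      also have "\<dots> \<le> norm x + M" using norm_triangle_ineq4[of x q] M by linarith
      finally show ?thesis using k by (simp add: abs_mult)
    qed
    also have "\<bar>p \<bullet> b\<bar> \<le> M" using Basis_le_norm[OF that, of p] M by linarith
    also have "k * (norm x + M) + M \<le> D * exp (k / 8 * (norm x)\<^sup>2)"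
    proof -
      have "norm x \<le> 1 + (norm x)\<^sup>2"
        using sum_squares_bound[of "norm x" 1] norm_ge_zero[of x] unfolding power2_eq_square by linarith
      then have "k * norm x \<le> k + k * (norm x)\<^sup>2"
        using k mult_left_mono[of "norm x" "1 + (norm x)\<^sup>2" k] by (simp add: algebra_simps)
      moreover have "1 + k / 8 * (norm x)\<^sup>2 \<le> exp (k / 8 * (norm x)\<^sup>2)"
        by (rule exp_ge_add_one_self)
      moreover have "0 \<le> k / 8 * (norm x)\<^sup>2" using k by simp
      moreover have "k * M \<le> k * \<bar>M\<bar>" "0 \<le> k * \<bar>M\<bar>" using k by auto
      ultimately have "k * norm x + k * M + M \<le> 8 * exp (k / 8 * (norm x)\<^sup>2) + (k + k * \<bar>M\<bar> + \<bar>M\<bar>)"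
        by linarith
      also have "(k + k * \<bar>M\<bar> + \<bar>M\<bar>) \<le> (k + k * \<bar>M\<bar> + \<bar>M\<bar>) * exp (k / 8 * (norm x)\<^sup>2)"
        using k kM mult_left_mono[of 1 "exp (k / 8 * (norm x)\<^sup>2)" "k + k * \<bar>M\<bar> + \<bar>M\<bar>"] by simp
      finally show ?thesis by (simp add: D_def algebra_simps)
    qed
    finally have "cmod (Complex (- k * ((x - q) \<bullet> b)) (p \<bullet> b)) \<le> D * exp (k / 8 * (norm x)\<^sup>2)"
      by simp
    from mult_right_mono[OF this, of "exp (- (k / 8) * (norm x)\<^sup>2)"]
    show ?thesis by (simp add: mult.assoc exp_add[symmetric])
  qed
  have C: "packet_const k M = C0 * D"
    by (simp add: packet_const_def C0_def D_def)
  have "C0 * exp (- (k / 4) * (norm x)\<^sup>2) \<le> C0 * (D * exp (- (k / 8) * (norm x)\<^sup>2))"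
  proof (rule mult_left_mono)
    have "exp (- (k / 4) * (norm x)\<^sup>2) \<le> 1 * exp (- (k / 8) * (norm x)\<^sup>2)"
      using k by simp
    also have "\<dots> \<le> D * exp (- (k / 8) * (norm x)\<^sup>2)"
      by (intro mult_right_mono D) simp
    finally show "exp (- (k / 4) * (norm x)\<^sup>2) \<le> D * exp (- (k / 8) * (norm x)\<^sup>2)" .
  qed (use D in simp)
  with 1 show "cmod (gauss_packet k c q p \<theta> x) \<le> packet_const k M * exp (- (k / 8) * (norm x)\<^sup>2)"
    unfolding C by (simp add: mult.assoc)
  assume b: "b \<in> Basis"
  have "cmod (gauss_packet k c q p \<theta> x * Complex (- k * ((x - q) \<bullet> b)) (p \<bullet> b))
    \<le> (C0 * exp (- (k / 4) * (norm x)\<^sup>2)) * cmod (Complex (- k * ((x - q) \<bullet> b)) (p \<bullet> b))"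
    unfolding norm_mult by (intro mult_right_mono 1) simp
  also have "\<dots> = C0 * exp (- (k / 8) * (norm x)\<^sup>2) *
      (cmod (Complex (- k * ((x - q) \<bullet> b)) (p \<bullet> b)) * exp (- (k / 8) * (norm x)\<^sup>2))"
    unfolding exp4 by (simp only: mult_ac)
  also have "\<dots> \<le> C0 * exp (- (k / 8) * (norm x)\<^sup>2) * D"
    by (intro mult_left_mono 2 b) (use D in simp)
  finally show "cmod (gauss_packet k c q p \<theta> x * Complex (- k * ((x - q) \<bullet> b)) (p \<bullet> b))
      \<le> packet_const k M * exp (- (k / 8) * (norm x)\<^sup>2)" unfolding C by (simp only: mult_ac)
qed

lemma gauss_packet_Sigma:
  assumes "k > 0"
  shows "gauss_packet k c q p \<theta> \<in> Sigma_space"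
proof -
  define M where "M = max \<bar>c\<bar> (max (norm q) (norm p))"
  have M: "\<bar>c\<bar> \<le> M" "norm q \<le> M" "norm p \<le> M" by (auto simp: M_def)
  show ?thesis
  proof (rule Sigma_gaussian_bound(1)[where K = "k / 8" and C = "packet_const k M", OF _ has_derivative_gauss_packet])
    show "continuous_on UNIV (\<lambda>x. gauss_packet k c q p \<theta> x * Complex (- k * ((x - q) \<bullet> b)) (p \<bullet> b))" for b
      by (rule continuous_on_gauss_packet_deriv)
  qed (use assms in simp, (intro gauss_packet_bounds assms M, assumption?)+)
qed

text \<open>The factor \<open>\<alpha>\<close> merges two uses: 0 gives continuity of the norm along
  the family, 1 gives continuity of the family in the norm. Convergent parameters are bounded, so a
  single \<open>M\<close> serves the whole sequence and its limit.\<close>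

lemma LIMSEQ_Sigma_norm_gauss_packet:
  fixes q p :: "nat \<Rightarrow> 'a::euclidean_space" and \<alpha> :: complex
  assumes k: "k > 0"
    and lim: "c \<longlonglongrightarrow> c0" "q \<longlonglongrightarrow> q0" "p \<longlonglongrightarrow> p0" "\<theta> \<longlonglongrightarrow> \<theta>0"
  shows "(\<lambda>n. Sigma_norm (\<lambda>x. gauss_packet k (c n) (q n) (p n) (\<theta> n) x - \<alpha> * gauss_packet k c0 q0 p0 \<theta>0 x))
    \<longlonglongrightarrow> Sigma_norm (\<lambda>x. gauss_packet k c0 q0 p0 \<theta>0 x - \<alpha> * gauss_packet k c0 q0 p0 \<theta>0 x)"
proof -
  have "Bseq c" "Bseq q" "Bseq p"
    using lim by (auto intro: convergent_imp_Bseq convergentI)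
  then obtain M1 M2 M3 where M: "\<And>n. norm (c n) \<le> M1" "\<And>n. norm (q n) \<le> M2" "\<And>n. norm (p n) \<le> M3"
    unfolding Bseq_def by blast
  define M where "M = max M1 (max M2 M3)"
  have Mn: "\<bar>c n\<bar> \<le> M" "norm (q n) \<le> M" "norm (p n) \<le> M" for n
    using M[of n] by (auto simp: M_def)
  have M0: "\<bar>c0\<bar> \<le> M" "norm q0 \<le> M" "norm p0 \<le> M"
    using Lim_norm_ubound[OF _ lim(1)] Lim_norm_ubound[OF _ lim(2)] Lim_norm_ubound[OF _ lim(3)] Mn
    by (simp_all add: always_eventually)
  let ?A = "packet_const k M"
  let ?C = "?A + cmod \<alpha> * ?A"
  let ?d = "\<lambda>c q p \<theta> x h. gauss_packet k c q p \<theta> x * Complex (- k * ((x - q) \<bullet> h)) (p \<bullet> h)"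
  have tri: "cmod (a - \<alpha> * b) \<le> ?C * g" if "cmod a \<le> ?A * g" "cmod b \<le> ?A * g" for a b g
  proof -
    have "cmod (a - \<alpha> * b) \<le> cmod a + cmod \<alpha> * cmod b"
      using norm_triangle_ineq4[of a "\<alpha> * b"] by (simp add: norm_mult)
    also have "\<dots> \<le> ?A * g + cmod \<alpha> * (?A * g)"
      by (intro add_mono mult_left_mono that) simp
    finally show ?thesis by (simp add: algebra_simps)
  qed
  have der: "((\<lambda>x. gauss_packet k c q p \<theta> x - \<alpha> * gauss_packet k c0 q0 p0 \<theta>0 x) has_derivative
      (\<lambda>h. ?d c q p \<theta> x h - \<alpha> * ?d c0 q0 p0 \<theta>0 x h)) (at x)" for c \<theta> and q p x :: 'a
    by (intro has_derivative_diff has_derivative_mult_right has_derivative_gauss_packet)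
  have lim_packet: "(\<lambda>n. gauss_packet k (c n) (q n) (p n) (\<theta> n) x) \<longlonglongrightarrow> gauss_packet k c0 q0 p0 \<theta>0 x" for x
    unfolding gauss_packet_def by (intro tendsto_intros lim)
  show ?thesis
  proof (rule tendsto_Sigma_norm_gaussian_bound[where K = "k / 8" and C = ?C, OF _ der der])
    fix n x and b :: 'a assume b: "b \<in> Basis"
    show "cmod (?d (c n) (q n) (p n) (\<theta> n) x b - \<alpha> * ?d c0 q0 p0 \<theta>0 x b)
        \<le> ?C * exp (- (k / 8) * (norm x)\<^sup>2)"
      by (intro tri gauss_packet_bounds k Mn M0 b)
    show "cmod (?d c0 q0 p0 \<theta>0 x b - \<alpha> * ?d c0 q0 p0 \<theta>0 x b) \<le> ?C * exp (- (k / 8) * (norm x)\<^sup>2)"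
      by (intro tri gauss_packet_bounds k Mn M0 b)
    show "(\<lambda>n. ?d (c n) (q n) (p n) (\<theta> n) x b - \<alpha> * ?d c0 q0 p0 \<theta>0 x b)
        \<longlonglongrightarrow> ?d c0 q0 p0 \<theta>0 x b - \<alpha> * ?d c0 q0 p0 \<theta>0 x b"
      by (intro tendsto_intros lim_packet lim)
    show "continuous_on UNIV (\<lambda>x. ?d (c n) (q n) (p n) (\<theta> n) x b - \<alpha> * ?d c0 q0 p0 \<theta>0 x b)"
      by (intro continuous_on_diff continuous_on_mult continuous_on_const continuous_on_gauss_packet_deriv)
    show "continuous_on UNIV (\<lambda>x. ?d c0 q0 p0 \<theta>0 x b - \<alpha> * ?d c0 q0 p0 \<theta>0 x b)"
      by (intro continuous_on_diff continuous_on_mult continuous_on_const continuous_on_gauss_packet_deriv)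
  next
    fix n x
    show "cmod (gauss_packet k (c n) (q n) (p n) (\<theta> n) x - \<alpha> * gauss_packet k c0 q0 p0 \<theta>0 x)
        \<le> ?C * exp (- (k / 8) * (norm x)\<^sup>2)"
      by (intro tri gauss_packet_bounds k Mn M0)
    show "cmod (gauss_packet k c0 q0 p0 \<theta>0 x - \<alpha> * gauss_packet k c0 q0 p0 \<theta>0 x)
        \<le> ?C * exp (- (k / 8) * (norm x)\<^sup>2)"
      by (intro tri gauss_packet_bounds k Mn M0)
    show "(\<lambda>n. gauss_packet k (c n) (q n) (p n) (\<theta> n) x - \<alpha> * gauss_packet k c0 q0 p0 \<theta>0 x)
        \<longlonglongrightarrow> gauss_packet k c0 q0 p0 \<theta>0 x - \<alpha> * gauss_packet k c0 q0 p0 \<theta>0 x"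
      by (intro tendsto_intros lim_packet)
  qed (use k in simp)
qed

lemma tendsto_Sigma_norm_gauss_packet:
  fixes q p :: "real \<Rightarrow> 'a::euclidean_space" and \<alpha> :: complex
  assumes k: "k > 0" and cont: "isCont c t" "isCont q t" "isCont p t" "isCont \<theta> t"
  shows "((\<lambda>s. Sigma_norm (\<lambda>x. gauss_packet k (c s) (q s) (p s) (\<theta> s) x
        - \<alpha> * gauss_packet k (c t) (q t) (p t) (\<theta> t) x))
    \<longlongrightarrow> Sigma_norm (\<lambda>x. gauss_packet k (c t) (q t) (p t) (\<theta> t) x
        - \<alpha> * gauss_packet k (c t) (q t) (p t) (\<theta> t) x)) (at t)"
  unfolding tendsto_at_iff_sequentially comp_def
  using cont[THEN isCont_tendsto_compose] by (auto intro!: LIMSEQ_Sigma_norm_gauss_packet k)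

section \<open>The equation and instability\<close>

text \<open>Links the iterated integrals of \<open>satisfies_E\<close> to the product space, on
  which the integrations by parts in time and space take place.\<close>

lemma lborel_iterated_integral:
  fixes f :: "'a::euclidean_space \<times> 'b::euclidean_space \<Rightarrow> complex"
  assumes "integrable lborel f"
  shows "(LINT t|lborel. LINT x|lborel. f (t, x)) = integral\<^sup>L lborel f"
  using lborel_pair.integral_fst'[of f] assms by (simp add: lborel_prod)

text \<open>After division by the packet, (E) is an identity between polynomials in x. With y = x -
  q, the coefficient of |y|^2 gives the quadratic equation for \<open>k\<close>;
  \<open>q' = p\<close> cancels the imaginary parts; \<open>p' = \<omega>^2 q\<close> matches the
  terms linear in x; the constants fix \<open>c\<close> and the phase. Up to a constant,
  \<open>\<theta>\<close> is nu t plus the classical action, the integral of (|p|^2 + omega^2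
  |q|^2)/2, minus p . q, the last term because the phase is written p . x rather than p . (x -
  q).\<close>

lemma satisfies_E_gauss_packet:
  fixes q p :: "real \<Rightarrow> 'a::euclidean_space"
  assumes k: "k\<^sup>2 + 2 * lam * k + \<omega>\<^sup>2 = 0" and lam: "lam \<noteq> 0"
    and c: "c = - (real DIM('a) * k / (4 * lam)) - \<nu> / (2 * lam)"
    and q': "\<And>t. (q has_vector_derivative p t) (at t)"
    and p': "\<And>t. (p has_vector_derivative \<omega>\<^sup>2 *\<^sub>R q t) (at t)"
    and \<theta>': "\<And>t. (\<theta> has_real_derivative \<nu> - (p t \<bullet> p t + \<omega>\<^sup>2 * (q t \<bullet> q t)) / 2) (at t)"
  shows "satisfies_E \<omega> lam (\<lambda>t. gauss_packet k c (q t) (p t) (\<theta> t))"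
  unfolding satisfies_E_def
proof (intro allI impI)
  fix \<psi> :: "real \<times> 'a \<Rightarrow> complex" assume \<psi>: "test_function \<psi>"
  define y where "y z = snd z - q (fst z)" for z
  define U where "U z = gauss_packet k c (q (fst z)) (p (fst z)) (\<theta> (fst z)) (snd z)" for z
  define dA where "dA z h = - k * (y z \<bullet> (snd h - fst h *\<^sub>R p (fst z)))" for z h
  define dB where "dB z h = p (fst z) \<bullet> snd h + fst h * (\<omega>\<^sup>2 * (q (fst z) \<bullet> snd z)
    + (\<nu> - (p (fst z) \<bullet> p (fst z) + \<omega>\<^sup>2 * (q (fst z) \<bullet> q (fst z))) / 2))" for z h
  \<comment> \<open>The logarithmic derivative of \<open>U\<close>: its derivative at
    \<open>z\<close> along \<open>h\<close> is \<open>U z * L z h\<close>.\<close>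
  define L where "L z h = Complex (dA z h) (dB z h)" for z h
  have dq: "((\<lambda>z. q (fst z)) has_derivative (\<lambda>h. fst h *\<^sub>R p (fst z))) (at z)" for z :: "real \<times> 'a"
    by (rule has_derivative_compose[OF _ q'[unfolded has_vector_derivative_def]])
      (auto intro!: derivative_eq_intros)
  have dp: "((\<lambda>z. p (fst z)) has_derivative (\<lambda>h. fst h *\<^sub>R (\<omega>\<^sup>2 *\<^sub>R q (fst z)))) (at z)" for z :: "real \<times> 'a"
    by (rule has_derivative_compose[OF _ p'[unfolded has_vector_derivative_def]])
      (auto intro!: derivative_eq_intros)
  have d\<theta>: "((\<lambda>z. \<theta> (fst z)) has_derivative (\<lambda>h. (\<nu> - (p (fst z) \<bullet> p (fst z)
      + \<omega>\<^sup>2 * (q (fst z) \<bullet> q (fst z))) / 2) * fst h)) (at z)" for z :: "real \<times> 'a"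
    by (rule has_derivative_compose[OF _ \<theta>'[unfolded has_field_derivative_def]])
      (auto intro!: derivative_eq_intros)
  have dy: "(y has_derivative (\<lambda>h. snd h - fst h *\<^sub>R p (fst z))) (at z)" for z
    unfolding y_def by (intro has_derivative_diff has_derivative_snd has_derivative_ident dq)
  have dU: "(U has_derivative (\<lambda>h. U z * L z h)) (at z)" for z
  proof -
    have "((\<lambda>z. c - k / 2 * (y z \<bullet> y z)) has_derivative dA z) (at z)"
      unfolding dA_def
      by (auto intro!: derivative_eq_intros dy simp: fun_eq_iff inner_commute field_simps)
    moreover have "((\<lambda>z. p (fst z) \<bullet> snd z + \<theta> (fst z)) has_derivative dB z) (at z)"
      unfolding dB_def
      by (auto intro!: derivative_eq_intros dp d\<theta> simp: inner_commute algebra_simps)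
    ultimately show ?thesis
      unfolding U_def gauss_packet_def L_def y_def[symmetric] by (rule has_derivative_exp_Complex)
  qed
  have cont: "continuous_on UNIV (\<lambda>z::real \<times> 'a. q (fst z))" "continuous_on UNIV (\<lambda>z::real \<times> 'a. p (fst z))"
    "continuous_on UNIV y" "continuous_on UNIV U"
    using dq dp dy dU
    by (meson continuous_at_imp_continuous_on has_derivative_continuous)+
  have Lb: "L z (0, b) = Complex (- k * (y z \<bullet> b)) (p (fst z) \<bullet> b)" for z b
    by (simp add: L_def dA_def dB_def)
  have Lt: "L z (1, 0) = Complex (k * (y z \<bullet> p (fst z))) (\<omega>\<^sup>2 * (q (fst z) \<bullet> snd z)
      + (\<nu> - (p (fst z) \<bullet> p (fst z) + \<omega>\<^sup>2 * (q (fst z) \<bullet> q (fst z))) / 2))" for z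
    by (simp add: L_def dA_def dB_def)
  \<comment> \<open>The derivative of \<open>L z (0, b)\<close> in \<open>z\<close>, so that the
    second derivative of \<open>U\<close> along \<open>(0, b)\<close> is \<open>U\<close> times dL +
    L^2.\<close>
  define dL where "dL z b h = Complex (- k * ((snd h - fst h *\<^sub>R p (fst z)) \<bullet> b)) (fst h * \<omega>\<^sup>2 * (q (fst z) \<bullet> b))"
    for z :: "real \<times> 'a" and b h
  have dLb: "((\<lambda>z. L z (0, b)) has_derivative dL z b) (at z)" for z b
    unfolding Lb dL_def Complex_eq
    by (auto intro!: derivative_eq_intros dp dy simp: algebra_simps)
  have dW: "((\<lambda>z. U z * L z (0, b)) has_derivative (\<lambda>h. U z * dL z b h + U z * L z h * L z (0, b))) (at z)" for z b
    by (rule has_derivative_mult[OF dU dLb])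
  have Basis: "(1, 0) \<in> (Basis :: (real \<times> 'a) set)" "b \<in> Basis \<Longrightarrow> (0, b) \<in> (Basis :: (real \<times> 'a) set)" for b :: 'a
    by (auto simp: Basis_prod_def)
  have "continuous_on UNIV (\<lambda>z. U z * L z (1, 0))"
    unfolding Lt Complex_eq by (intro continuous_intros cont) simp
  note It = integral_by_parts_test_function[OF \<psi> Basis(1) dU this]
  have cW: "continuous_on UNIV (\<lambda>z. U z * L z (0, b))" for b
    unfolding Lb Complex_eq by (intro continuous_intros cont)
  have cW': "continuous_on UNIV (\<lambda>z. U z * dL z b (0, b) + U z * L z (0, b) * L z (0, b))" for b
    unfolding Lb dL_def Complex_eq by (intro continuous_intros cont)
  have Ib: "integrable lborel (\<lambda>z. U z * dir_deriv (0, b) (dir_deriv (0, b) \<psi>) z)"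
    "integrable lborel (\<lambda>z. (U z * dL z b (0, b) + U z * L z (0, b) * L z (0, b)) * \<psi> z)"
    "(LINT z|lborel. U z * dir_deriv (0, b) (dir_deriv (0, b) \<psi>) z) =
      (LINT z|lborel. (U z * dL z b (0, b) + U z * L z (0, b) * L z (0, b)) * \<psi> z)"
    if b: "b \<in> Basis" for b
  proof -
    \<comment> \<open>Two integrations by parts, first against the derivative of
      \<open>\<psi>\<close> and then against \<open>\<psi>\<close>; the two signs cancel.\<close>
    note I1 = integral_by_parts_test_function[OF test_function_dir_deriv[OF \<psi> Basis(2)[OF b]] Basis(2)[OF b] dU cW]
    note I2 = integral_by_parts_test_function[OF \<psi> Basis(2)[OF b] dW cW']
    show "integrable lborel (\<lambda>z. U z * dir_deriv (0, b) (dir_deriv (0, b) \<psi>) z)" by (rule I1(1))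
    show "integrable lborel (\<lambda>z. (U z * dL z b (0, b) + U z * L z (0, b) * L z (0, b)) * \<psi> z)" by (rule I2(2))
    show "(LINT z|lborel. U z * dir_deriv (0, b) (dir_deriv (0, b) \<psi>) z) =
      (LINT z|lborel. (U z * dL z b (0, b) + U z * L z (0, b) * L z (0, b)) * \<psi> z)"
      using I1(3) I2(3) by simp
  qed
  let ?lhs = "\<lambda>z. U z * (- \<i> * dir_deriv (1, 0) \<psi> z
     + (1/2) * (\<Sum>b\<in>Basis. dir_deriv (0, b) (dir_deriv (0, b) \<psi>) z))"
  let ?rhs = "\<lambda>z. (- of_real (\<omega>\<^sup>2 * (norm (snd z))\<^sup>2 / 2) * U z + of_real lam * log_nonlin (U z)) * \<psi> z"
  have lhs: "?lhs z = - \<i> * (U z * dir_deriv (1, 0) \<psi> z)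
     + (1/2) * (\<Sum>b\<in>Basis. U z * dir_deriv (0, b) (dir_deriv (0, b) \<psi>) z)" for z
    by (simp add: algebra_simps sum_distrib_left)
  have rhs: "?rhs z = \<i> * (U z * L z (1, 0) * \<psi> z)
     + (1/2) * (\<Sum>b\<in>Basis. (U z * dL z b (0, b) + U z * L z (0, b) * L z (0, b)) * \<psi> z)" for z
  proof -
    have sum1: "(\<Sum>b\<in>(Basis::'a set). dL z b (0, b)) = - of_real (k * DIM('a))"
      by (simp add: dL_def complex_eq_iff)
    have sum2: "(\<Sum>b\<in>Basis. L z (0, b) * L z (0, b)) =
        Complex (k\<^sup>2 * (y z \<bullet> y z) - p (fst z) \<bullet> p (fst z)) (- 2 * k * (y z \<bullet> p (fst z)))"
    proof (rule complex_eqI)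
      show "Re (\<Sum>b\<in>Basis. L z (0, b) * L z (0, b)) =
          Re (Complex (k\<^sup>2 * (y z \<bullet> y z) - p (fst z) \<bullet> p (fst z)) (- 2 * k * (y z \<bullet> p (fst z))))"
        by (subst (1) euclidean_inner[of "y z" "y z"], subst (1) euclidean_inner[of "p (fst z)" "p (fst z)"])
          (simp add: Lb sum_distrib_left sum_subtractf power2_eq_square mult_ac)
      show "Im (\<Sum>b\<in>Basis. L z (0, b) * L z (0, b)) =
          Im (Complex (k\<^sup>2 * (y z \<bullet> y z) - p (fst z) \<bullet> p (fst z)) (- 2 * k * (y z \<bullet> p (fst z))))"
        unfolding complex.sel
        by (subst euclidean_inner[of "y z" "p (fst z)"])
          (simp add: Lb sum_distrib_left sum_negf[symmetric] sum.distrib[symmetric] mult_ac)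
    qed
    have y: "y z \<bullet> y z = snd z \<bullet> snd z - 2 * (q (fst z) \<bullet> snd z) + q (fst z) \<bullet> q (fst z)"
      by (simp add: y_def inner_diff inner_commute algebra_simps)
    have "ln ((cmod (U z))\<^sup>2) = 2 * (c - k / 2 * (y z \<bullet> y z))"
      unfolding U_def cmod_gauss_packet y_def[symmetric] by (simp add: ln_realpow)
    then have log: "log_nonlin (U z) = U z * of_real (2 * (c - k / 2 * (y z \<bullet> y z)))"
      by (simp add: log_nonlin_def)
    have 2: "2 * lam * c = - (real DIM('a) * k / 2) - \<nu>"
      using lam by (simp add: c field_simps)
    have k2: "k\<^sup>2 = - 2 * lam * k - \<omega>\<^sup>2" using k by linarith
    \<comment> \<open>The real part of (E) divided by \<open>U\<close>. In the imaginary part, the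
      term k y . p from the moving centre cancels against the cross term of the squared
      gradient.\<close>
    have re: "- (\<omega>\<^sup>2 * (norm (snd z))\<^sup>2 / 2) + lam * (2 * (c - k / 2 * (y z \<bullet> y z)))
      = - (\<omega>\<^sup>2 * (q (fst z) \<bullet> snd z) + (\<nu> - (p (fst z) \<bullet> p (fst z) + \<omega>\<^sup>2 * (q (fst z) \<bullet> q (fst z))) / 2))
        + (1 / 2) * (k\<^sup>2 * (y z \<bullet> y z) - p (fst z) \<bullet> p (fst z) - k * real DIM('a))"
    proof -
      have "lam * (2 * (c - k / 2 * (y z \<bullet> y z))) = 2 * lam * c - lam * k * (y z \<bullet> y z)"
        by (simp add: algebra_simps)
      then show ?thesis unfolding 2 k2 y power2_norm_eq_inner by (simp add: field_simps)
    qed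
    have key: "- of_real (\<omega>\<^sup>2 * (norm (snd z))\<^sup>2 / 2) + of_real lam * of_real (2 * (c - k / 2 * (y z \<bullet> y z)))
        = \<i> * L z (1, 0) + (1/2) * ((\<Sum>b\<in>(Basis::'a set). dL z b (0, b)) + (\<Sum>b\<in>Basis. L z (0, b) * L z (0, b)))"
      unfolding sum1 sum2 Lt using re by (simp add: complex_eq_iff)
    have "?rhs z = (- of_real (\<omega>\<^sup>2 * (norm (snd z))\<^sup>2 / 2) + of_real lam * of_real (2 * (c - k / 2 * (y z \<bullet> y z))))
        * (U z * \<psi> z)"
      unfolding log by (simp only: algebra_simps)
    also have "\<dots> = \<i> * (U z * L z (1, 0) * \<psi> z)
     + (1/2) * (\<Sum>b\<in>Basis. (U z * dL z b (0, b) + U z * L z (0, b) * L z (0, b)) * \<psi> z)"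
      unfolding key by (simp add: algebra_simps sum_distrib_left sum.distrib)
    finally show ?thesis .
  qed
  have "integrable lborel ?lhs"
    unfolding lhs by (intro Bochner_Integration.integrable_add integrable_mult_right Bochner_Integration.integrable_sum It Ib)
  moreover have "integrable lborel ?rhs"
    unfolding rhs by (intro Bochner_Integration.integrable_add integrable_mult_right Bochner_Integration.integrable_sum It Ib)
  moreover have "integral\<^sup>L lborel ?lhs = integral\<^sup>L lborel ?rhs"
  proof -
    have "integral\<^sup>L lborel ?lhs = - \<i> * (LINT z|lborel. U z * dir_deriv (1, 0) \<psi> z)
     + (1/2) * (\<Sum>b\<in>Basis. LINT z|lborel. U z * dir_deriv (0, b) (dir_deriv (0, b) \<psi>) z)"
      unfolding lhs using It(1) Ib(1)
      by (subst Bochner_Integration.integral_add) (auto intro!: Bochner_Integration.integrable_sum)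
    also have "\<dots> = \<i> * (LINT z|lborel. U z * L z (1, 0) * \<psi> z)
     + (1/2) * (\<Sum>b\<in>Basis. LINT z|lborel. (U z * dL z b (0, b) + U z * L z (0, b) * L z (0, b)) * \<psi> z)"
      by (simp add: It(3) Ib(3))
    also have "\<dots> = integral\<^sup>L lborel ?rhs"
      unfolding rhs using It(2) Ib(2)
      by (subst Bochner_Integration.integral_add) (auto intro!: Bochner_Integration.integrable_sum)
    finally show ?thesis .
  qed
  ultimately show "(LINT t|lborel. LINT x|lborel. gauss_packet k c (q t) (p t) (\<theta> t) x *
            (- \<i> * dir_deriv (1, 0) \<psi> (t, x)
             + (1/2) * (\<Sum>b\<in>Basis. dir_deriv (0, b) (dir_deriv (0, b) \<psi>) (t, x))))
      = (LINT t|lborel. LINT x|lborel.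
            (- of_real (\<omega>\<^sup>2 * (norm x)\<^sup>2 / 2) * gauss_packet k c (q t) (p t) (\<theta> t) x
              + of_real lam * log_nonlin (gauss_packet k c (q t) (p t) (\<theta> t) x))
            * \<psi> (t, x))"
    using lborel_iterated_integral[of ?lhs] lborel_iterated_integral[of ?rhs]
    by (simp add: U_def)
qed

text \<open>The norm of Sigma is continuous along the trajectory, hence bounded on compact time
  intervals, and continuity in that norm implies continuity in L2.\<close>

lemma solution_E_gauss_packet:
  fixes q p :: "real \<Rightarrow> 'a::euclidean_space"
  assumes k: "k > 0" "k\<^sup>2 + 2 * lam * k + \<omega>\<^sup>2 = 0" and lam: "lam \<noteq> 0"
    and c: "c = - (real DIM('a) * k / (4 * lam)) - \<nu> / (2 * lam)"
    and q': "\<And>t. (q has_vector_derivative p t) (at t)"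
    and p': "\<And>t. (p has_vector_derivative \<omega>\<^sup>2 *\<^sub>R q t) (at t)"
    and \<theta>': "\<And>t. (\<theta> has_real_derivative \<nu> - (p t \<bullet> p t + \<omega>\<^sup>2 * (q t \<bullet> q t)) / 2) (at t)"
  shows "solution_E \<omega> lam (\<lambda>t. gauss_packet k c (q t) (p t) (\<theta> t))"
proof -
  let ?u = "\<lambda>t. gauss_packet k c (q t) (p t) (\<theta> t)"
  have cont: "isCont (\<lambda>_. c) t" "isCont q t" "isCont p t" "isCont \<theta> t" for t
    using q' p' \<theta>' by (auto intro: has_vector_derivative_continuous DERIV_isCont)
  note lim = tendsto_Sigma_norm_gauss_packet[OF k(1) cont]
  have "isCont (\<lambda>t. Sigma_norm (?u t)) t" for t
    using lim[of 0 t] by (simp add: isCont_def)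
  then have "continuous_on {-T..T} (\<lambda>t. Sigma_norm (?u t))" for T
    by (intro continuous_at_imp_continuous_on) auto
  then have "\<exists>C. \<forall>t\<in>{-T..T}. Sigma_norm (?u t) \<le> C" for T
    using compact_imp_bounded[OF compact_continuous_image[of "{-T..T}" "\<lambda>t. Sigma_norm (?u t)"]]
    unfolding bounded_iff by (auto dest: abs_le_D1)
  moreover have "((\<lambda>s. L2_norm (\<lambda>x. ?u s x - ?u t x)) \<longlongrightarrow> 0) (at t)" for t
  proof (rule tendsto_sandwich[OF _ _ tendsto_const])
    show "\<forall>\<^sub>F s in at t. 0 \<le> L2_norm (\<lambda>x. ?u s x - ?u t x)"
      by (simp add: L2_norm_def)
    show "\<forall>\<^sub>F s in at t. L2_norm (\<lambda>x. ?u s x - ?u t x) \<le> Sigma_norm (\<lambda>x. ?u s x - ?u t x)"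
      by (simp add: L2_norm_le_Sigma_norm)
    show "((\<lambda>s. Sigma_norm (\<lambda>x. ?u s x - ?u t x)) \<longlongrightarrow> 0) (at t)"
      using lim[of 1 t] by (simp add: Sigma_norm_zero)
  qed
  ultimately show ?thesis
    unfolding solution_E_def
    using gauss_packet_Sigma[OF k(1)] satisfies_E_gauss_packet[OF k(2) lam c q' p' \<theta>'] by blast
qed

section \<open>Separation of the translated wave and instability\<close>

lemma gauss_packet_overlap:
  fixes q p :: "'a::euclidean_space"
  assumes k: "k > 0" and far: "k / 4 * (q \<bullet> q) \<ge> 1"
  shows "L2_norm (gauss_packet k c (0::'a) 0 0)
    \<le> L2_norm (\<lambda>x. gauss_packet k c q p \<theta> x - cis \<theta>' * gauss_packet k c 0 0 0 x)"
proof -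
  \<comment> \<open>The squared modulus of any packet centred at \<open>w\<close>. All these
    functions are translates of \<open>G 0\<close> and have the same integral.\<close>
  define G where "G w x = exp (2 * c - k * ((x - w) \<bullet> (x - w)))" for w x :: 'a
  have sq: "(cmod (gauss_packet k c w p \<theta> x))\<^sup>2 = G w x" for w p \<theta> x
    unfolding cmod_gauss_packet G_def by (simp add: exp_double[symmetric] algebra_simps)
  have L2: "gauss_packet k c w p \<theta> \<in> L2" for w p :: 'a and \<theta>
    using gauss_packet_Sigma[OF k] by (auto simp: Sigma_space_def H1_def)
  have int: "integrable lborel (G w)" for w
    using L2[of w 0 0] by (simp add: L2_def sq)
  have J: "integral\<^sup>L lborel (G w) = integral\<^sup>L lborel (G 0)" for w
  proof -
    have "(\<lambda>x. G w (w + x)) = G 0" by (simp add: G_def fun_eq_iff)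
    with lborel_integral_translate[of "G w" w] int[of w] show ?thesis by simp
  qed
  have "exp (- (k / 4 * (q \<bullet> q))) \<le> exp (- 1)" using far by simp
  also have "\<dots> \<le> 1 / 2"
    using exp_ge_add_one_self[of 1] by (simp add: exp_minus field_simps)
  finally have half: "exp (- (k / 4 * (q \<bullet> q))) \<le> 1 / 2" .
  \<comment> \<open>Only moduli enter, so the bound holds for every phase: |z - w|^2 is at least a^2
    + b^2 - 2ab, and the product ab is a Gaussian centred at the midpoint q/2 with the damping
    factor exp(-k |q|^2 / 4), which is at most 1/2.\<close>
  have point: "G q x + G 0 x - G (q /\<^sub>R 2) x
      \<le> (cmod (gauss_packet k c q p \<theta> x - cis \<theta>' * gauss_packet k c 0 0 0 x))\<^sup>2" for x
  proof -
    let ?a = "cmod (gauss_packet k c q p \<theta> x)" and ?b = "cmod (gauss_packet k c (0::'a) 0 0 x)"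
    have mid: "(x - q /\<^sub>R 2) \<bullet> (x - q /\<^sub>R 2) = ((x - q) \<bullet> (x - q)) / 2 + (x \<bullet> x) / 2 - (q \<bullet> q) / 4"
      by (simp add: inner_diff inner_commute field_simps)
    have "?a * ?b = exp (- (k / 4 * (q \<bullet> q))) * G (q /\<^sub>R 2) x"
    proof -
      have "c - k / 2 * A + (c - k / 2 * B) = - (k / 4 * Q) + (2 * c - k * (A / 2 + B / 2 - Q / 4))"
        for A B Q :: real by (simp add: field_simps)
      then show ?thesis
        unfolding cmod_gauss_packet G_def exp_add[symmetric] mid diff_zero by (rule arg_cong)
    qed
    also have "\<dots> \<le> 1 / 2 * G (q /\<^sub>R 2) x"
      by (intro mult_right_mono half) (simp add: G_def)
    finally have ab: "2 * (?a * ?b) \<le> G (q /\<^sub>R 2) x" by simp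
    have "\<bar>?a - ?b\<bar> \<le> cmod (gauss_packet k c q p \<theta> x - cis \<theta>' * gauss_packet k c 0 0 0 x)"
      using norm_triangle_ineq3[of "gauss_packet k c q p \<theta> x" "cis \<theta>' * gauss_packet k c 0 0 0 x"]
      by (simp add: norm_mult)
    then have "(?a - ?b)\<^sup>2 \<le> (cmod (gauss_packet k c q p \<theta> x - cis \<theta>' * gauss_packet k c 0 0 0 x))\<^sup>2"
      by (metis abs_ge_zero power2_abs power_mono)
    moreover have "(?a - ?b)\<^sup>2 = ?a\<^sup>2 + ?b\<^sup>2 - 2 * (?a * ?b)"
      by (simp add: power2_diff)
    ultimately show ?thesis using ab by (simp only: sq)
  qed
  \<comment> \<open>The three terms on the right have equal integrals, so two of them
    cancel.\<close>
  have "(LINT x|lborel. G 0 x) = (LINT x|lborel. G q x + G 0 x - G (q /\<^sub>R 2) x)"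
    using int J[of q] J[of "q /\<^sub>R 2"] by simp
  also have "\<dots> \<le> (LINT x|lborel. (cmod (gauss_packet k c q p \<theta> x - cis \<theta>' * gauss_packet k c 0 0 0 x))\<^sup>2)"
  proof (rule integral_mono)
    have "(\<lambda>x. cis \<theta>' * gauss_packet k c (0::'a) 0 0 x) \<in> L2"
      using L2[of 0 0 0] by (auto simp: L2_def norm_mult)
    then show "integrable lborel (\<lambda>x. (cmod (gauss_packet k c q p \<theta> x - cis \<theta>' * gauss_packet k c 0 0 0 x))\<^sup>2)"
      using L2_diff[OF L2[of q p \<theta>]] by (auto simp: L2_def)
  qed (use int point in auto)
  finally show ?thesis by (simp add: L2_norm_def sq)
qed

lemma L2_norm_gauss_packet_pos:
  assumes "k > 0"
  shows "L2_norm (gauss_packet k c q p \<theta>) > 0"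
proof -
  let ?g = "\<lambda>x. (cmod (gauss_packet k c q p \<theta> x))\<^sup>2"
  have int: "integrable lborel ?g"
    using gauss_packet_Sigma[OF assms] by (auto simp: Sigma_space_def H1_def L2_def)
  have "integral\<^sup>L lborel ?g \<noteq> 0"
  proof
    assume "integral\<^sup>L lborel ?g = 0"
    then have "AE x in lborel. ?g x = 0"
      using integral_nonneg_eq_0_iff_AE[OF int] by simp
    then have "AE x::'a in lborel. False" by (simp add: gauss_packet_def)
    then show False
      using ae_filter_eq_bot_iff[of "lborel :: 'a measure"] by (simp add: trivial_limit_def)
  qed
  then show ?thesis
    by (simp add: L2_norm_def less_le)
qed

lemma unstable_gauss_packet:
  fixes \<omega> lam :: real
  assumes \<omega>: "\<omega> > 0" and k: "k > 0" "k\<^sup>2 + 2 * lam * k + \<omega>\<^sup>2 = 0" and lam: "lam \<noteq> 0"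
    and c: "c = - (real DIM('a::euclidean_space) * k / (4 * lam)) - \<nu> / (2 * lam)"
  shows "unstable \<omega> lam (gauss_packet k c (0::'a) 0 0)"
proof
  let ?\<phi> = "gauss_packet k c (0::'a) 0 0"
  assume stable: "orbitally_stable \<omega> lam ?\<phi>"
  \<comment> \<open>The lower bound of \<open>gauss_packet_overlap\<close>, fixed before the size of
    the perturbation is known.\<close>
  define \<epsilon> where "\<epsilon> = L2_norm ?\<phi>"
  have "\<epsilon> > 0" unfolding \<epsilon>_def by (rule L2_norm_gauss_packet_pos[OF k(1)])
  with stable obtain \<eta> where \<eta>: "\<eta> > 0"
    and small: "\<And>u0 u. u0 \<in> Sigma_space \<Longrightarrow> Sigma_norm (\<lambda>x. u0 x - ?\<phi> x) < \<eta> \<Longrightarrow> solves_ivp \<omega> lam u0 u \<Longrightarrow>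
      (SUP t. INF \<theta>. ennreal (Sigma_norm (\<lambda>x. u t x - cis \<theta> * ?\<phi> x))) < ennreal \<epsilon>"
    unfolding orbitally_stable_def by meson
  obtain v :: 'a where v: "v \<in> Basis" using nonempty_Basis by blast
  have "((\<lambda>\<delta>. Sigma_norm (\<lambda>x. gauss_packet k c (\<delta> *\<^sub>R v) 0 0 x - ?\<phi> x)) \<longlongrightarrow> 0) (at 0)"
    using tendsto_Sigma_norm_gauss_packet[OF k(1), where c = "\<lambda>_. c" and t = 0
        and q = "\<lambda>\<delta>. \<delta> *\<^sub>R v" and p = "\<lambda>_. 0" and \<theta> = "\<lambda>_. 0" and \<alpha> = 1]
    by (simp add: Sigma_norm_zero)
  then have "\<forall>\<^sub>F \<delta> in at 0. Sigma_norm (\<lambda>x. gauss_packet k c (\<delta> *\<^sub>R v) 0 0 x - ?\<phi> x) < \<eta>"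
    using \<eta> by (rule order_tendstoD)
  then obtain d where d: "d > 0" "\<And>\<delta>. \<delta> \<noteq> 0 \<Longrightarrow> dist \<delta> 0 < d \<Longrightarrow>
      Sigma_norm (\<lambda>x. gauss_packet k c (\<delta> *\<^sub>R v) 0 0 x - ?\<phi> x) < \<eta>"
    unfolding eventually_at by blast
  define \<delta> where "\<delta> = d / 2"
  have \<delta>: "\<delta> > 0" "Sigma_norm (\<lambda>x. gauss_packet k c (\<delta> *\<^sub>R v) 0 0 x - ?\<phi> x) < \<eta>"
    using d by (auto simp: \<delta>_def)
  \<comment> \<open>The trajectory released at rest from \<open>\<delta> *\<^sub>R v\<close>, so
    that the initial datum is the profile merely translated, with no added phase.\<close>
  define q where "q t = (\<delta> * cosh (\<omega> * t)) *\<^sub>R v" for t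
  define p where "p t = (\<delta> * \<omega> * sinh (\<omega> * t)) *\<^sub>R v" for t
  \<comment> \<open>Explicit integral of the phase equation: |p|^2 + omega^2 |q|^2 is delta^2
    omega^2 (sinh^2 + cosh^2), and sinh^2 + cosh^2 is the derivative of sinh * cosh.\<close>
  define \<theta> where "\<theta> t = \<nu> * t - \<omega> * \<delta>\<^sup>2 / 2 * (sinh (\<omega> * t) * cosh (\<omega> * t))" for t
  define u where "u t = gauss_packet k c (q t) (p t) (\<theta> t)" for t
  have "solution_E \<omega> lam u"
    unfolding u_def
  proof (rule solution_E_gauss_packet[OF k lam c])
    fix t
    have vv: "v \<bullet> v = 1" using v by (simp add: inner_Basis)
    show "(q has_vector_derivative p t) (at t)"
      unfolding q_def p_def by (auto intro!: derivative_eq_intros)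
    show "(p has_vector_derivative \<omega>\<^sup>2 *\<^sub>R q t) (at t)"
      unfolding q_def p_def by (auto intro!: derivative_eq_intros simp: power2_eq_square)
    show "(\<theta> has_real_derivative \<nu> - (p t \<bullet> p t + \<omega>\<^sup>2 * (q t \<bullet> q t)) / 2) (at t)"
      unfolding \<theta>_def
      by (auto intro!: derivative_eq_intros simp: p_def q_def vv power2_eq_square algebra_simps)
  qed
  moreover have "u 0 = gauss_packet k c (\<delta> *\<^sub>R v) 0 0"
    by (simp add: u_def q_def p_def \<theta>_def)
  ultimately have "solves_ivp \<omega> lam (gauss_packet k c (\<delta> *\<^sub>R v) 0 0) u"
    by (simp add: solves_ivp_def)
  from small[OF gauss_packet_Sigma[OF k(1)] \<delta>(2) this]
  have less: "(SUP t. INF \<theta>. ennreal (Sigma_norm (\<lambda>x. u t x - cis \<theta> * ?\<phi> x))) < ennreal \<epsilon>" .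
  \<comment> \<open>The target value of cosh: the second entry makes |q|^2 at least 4/k, as the
    overlap estimate requires, and the first keeps \<open>R\<close> in the domain where
    \<open>arcosh\<close> inverts \<open>cosh\<close>.\<close>
  define R where "R = max 1 (2 / (\<delta> * sqrt k))"
  define t where "t = arcosh R / \<omega>"
  have "cosh (\<omega> * t) = R" using \<omega> by (simp add: t_def R_def)
  then have "q t \<bullet> q t = (\<delta> * R)\<^sup>2"
    using v by (simp add: q_def inner_Basis power2_eq_square)
  moreover have "(2 / sqrt k)\<^sup>2 \<le> (\<delta> * R)\<^sup>2"
  proof (rule power_mono)
    have "2 / sqrt k = \<delta> * (2 / (\<delta> * sqrt k))" using \<delta> by simp
    also have "\<dots> \<le> \<delta> * R" using \<delta> by (intro mult_left_mono) (auto simp: R_def)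
    finally show "2 / sqrt k \<le> \<delta> * R" .
  qed (use k in simp)
  ultimately have far: "k / 4 * (q t \<bullet> q t) \<ge> 1"
    using k(1) by (simp add: power_divide field_simps)
  have "ennreal \<epsilon> \<le> (INF \<theta>. ennreal (Sigma_norm (\<lambda>x. u t x - cis \<theta> * ?\<phi> x)))"
  proof (rule INF_greatest, rule ennreal_leI)
    fix \<theta>'
    have "\<epsilon> \<le> L2_norm (\<lambda>x. u t x - cis \<theta>' * ?\<phi> x)"
      unfolding \<epsilon>_def u_def by (rule gauss_packet_overlap[OF k(1) far])
    also have "\<dots> \<le> Sigma_norm (\<lambda>x. u t x - cis \<theta>' * ?\<phi> x)" by (rule L2_norm_le_Sigma_norm)
    finally show "\<epsilon> \<le> Sigma_norm (\<lambda>x. u t x - cis \<theta>' * ?\<phi> x)" .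
  qed
  also have "\<dots> \<le> (SUP t. INF \<theta>. ennreal (Sigma_norm (\<lambda>x. u t x - cis \<theta> * ?\<phi> x)))"
    by (rule SUP_upper) simp
  finally show False using less by simp
qed

section \<open>The stated Gaussian profiles as packets, and the conclusion\<close>

lemma of_real_phi_nu:
  "complex_of_real (phi_nu lam k \<nu> x) =
    gauss_packet k (- (real DIM('a) * k / (4 * lam)) - \<nu> / (2 * lam)) 0 0 0 (x::'a::euclidean_space)"
proof -
  have "phi_nu lam k \<nu> x =
      exp (- (real DIM('a) * k / (4 * lam)) - \<nu> / (2 * lam) - k / 2 * ((x - 0) \<bullet> (x - 0)))"
    unfolding phi_nu_def phi_def exp_add[symmetric] power2_norm_eq_inner by simp
  then show ?thesis by (simp add: gauss_packet_def exp_eq_polar)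
qed

lemma standing_wave_phi_nu:
  "standing_wave \<nu> (\<lambda>x::'a. complex_of_real (phi_nu lam k \<nu> x)) t =
    gauss_packet k (- (real DIM('a::euclidean_space) * k / (4 * lam)) - \<nu> / (2 * lam)) 0 0 (\<nu> * t)"
  unfolding standing_wave_def of_real_phi_nu
  by (auto simp: gauss_packet_def exp_eq_polar fun_eq_iff)

lemma phi_eq_phi_nu_0: "phi lam k = phi_nu lam k 0"
  by (simp add: phi_nu_def fun_eq_iff)

lemma solitary_waves:
  fixes \<omega> lam k :: real
  assumes "\<omega> > 0" "k > 0" "k\<^sup>2 + 2 * lam * k + \<omega>\<^sup>2 = 0" "lam \<noteq> 0"
  shows "solution_E \<omega> lam (\<lambda>t (x::'a::euclidean_space). of_real (phi lam k x))"
    and "continuous_family (\<lambda>\<nu> (x::'a). of_real (phi_nu lam k \<nu> x))"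
    and "solution_E \<omega> lam (standing_wave \<nu> (\<lambda>x::'a. of_real (phi_nu lam k \<nu> x)))"
    and "unstable \<omega> lam (\<lambda>x::'a. of_real (phi_nu lam k \<nu> x))"
proof -
  have sol: "solution_E \<omega> lam (\<lambda>t. gauss_packet k
      (- (real DIM('a) * k / (4 * lam)) - \<nu> / (2 * lam)) (0::'a) 0 (\<nu> * t))" for \<nu>
    \<comment> \<open>The solitary waves sit at the equilibrium of q'' = omega^2 q, where the phase
      equation reduces to \<theta>' = nu.\<close>
    by (rule solution_E_gauss_packet[where \<nu> = \<nu> and q = "\<lambda>_. 0" and p = "\<lambda>_. 0"])
      (use assms in \<open>auto intro!: derivative_eq_intros\<close>)
  show "solution_E \<omega> lam (\<lambda>t (x::'a). of_real (phi lam k x))"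
    using sol[of 0] by (simp add: phi_eq_phi_nu_0 of_real_phi_nu)
  show "solution_E \<omega> lam (standing_wave \<nu> (\<lambda>x::'a. of_real (phi_nu lam k \<nu> x)))"
    using sol[of \<nu>] by (subst standing_wave_phi_nu[abs_def])
  show "continuous_family (\<lambda>\<nu> (x::'a). of_real (phi_nu lam k \<nu> x))"
    unfolding continuous_family_def of_real_phi_nu
  proof (intro conjI allI)
    fix \<nu>
    show "gauss_packet k (- (real DIM('a) * k / (4 * lam)) - \<nu> / (2 * lam)) (0::'a) 0 0 \<in> Sigma_space"
      by (rule gauss_packet_Sigma[OF assms(2)])
    have "isCont (\<lambda>\<nu>. - (real DIM('a) * k / (4 * lam)) - \<nu> / (2 * lam)) \<nu>"
      using assms(4) by (intro continuous_intros) auto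
    from tendsto_Sigma_norm_gauss_packet[OF assms(2) this, where q = "\<lambda>_. 0::'a" and p = "\<lambda>_. 0"
        and \<theta> = "\<lambda>_. 0" and \<alpha> = 1]
    show "((\<lambda>\<mu>. Sigma_norm (\<lambda>x::'a. gauss_packet k (- (real DIM('a) * k / (4 * lam)) - \<mu> / (2 * lam)) 0 0 0 x
        - gauss_packet k (- (real DIM('a) * k / (4 * lam)) - \<nu> / (2 * lam)) 0 0 0 x)) \<longlongrightarrow> 0) (at \<nu>)"
      by (simp add: Sigma_norm_zero)
  qed
  show "unstable \<omega> lam (\<lambda>x::'a. of_real (phi_nu lam k \<nu> x))"
    unfolding of_real_phi_nu
    by (rule unstable_gauss_packet[OF assms refl])
qed

theorem theorem1p2:
  fixes \<omega> lam :: real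
  shows
    "(- lam > \<omega> \<and> \<omega> > 0 \<longrightarrow>
        (phi lam (k_plus \<omega> lam) :: 'a::euclidean_space \<Rightarrow> real) \<noteq> phi lam (k_minus \<omega> lam) \<and>
        (\<forall>k\<in>{k_plus \<omega> lam, k_minus \<omega> lam}.
           (\<forall>x::'a. phi lam k x > 0) \<and>
           solution_E \<omega> lam (\<lambda>t (x::'a). of_real (phi lam k x)) \<and>
           continuous_family (\<lambda>\<nu> (x::'a). of_real (phi_nu lam k \<nu> x)) \<and>
           (\<forall>\<nu>. solution_E \<omega> lam (standing_wave \<nu> (\<lambda>x::'a. of_real (phi_nu lam k \<nu> x))) \<and>
                 unstable \<omega> lam (\<lambda>x::'a. of_real (phi_nu lam k \<nu> x)))))
     \<and>
     (- lam = \<omega> \<and> \<omega> > 0 \<longrightarrow>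
        k_minus \<omega> lam = \<omega> \<and> k_plus \<omega> lam = \<omega> \<and>
        (phi lam (k_minus \<omega> lam) :: 'a \<Rightarrow> real) = phi_crit \<omega> \<and>
        (phi lam (k_plus \<omega> lam) :: 'a \<Rightarrow> real) = phi_crit \<omega> \<and>
        solution_E \<omega> lam (\<lambda>t (x::'a). of_real (phi_crit \<omega> x)) \<and>
        continuous_family (\<lambda>\<nu> (x::'a). of_real (phi_crit_nu \<omega> \<nu> x)) \<and>
        (\<forall>\<nu>. solution_E \<omega> lam (standing_wave \<nu> (\<lambda>x::'a. of_real (phi_crit_nu \<omega> \<nu> x))) \<and>
              unstable \<omega> lam (\<lambda>x::'a. of_real (phi_crit_nu \<omega> \<nu> x))))"
proof (intro conjI impI)
  assume A: "- lam > \<omega> \<and> \<omega> > 0"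
  define s where "s = sqrt (lam\<^sup>2 - \<omega>\<^sup>2)"
  have "\<omega>\<^sup>2 < (- lam)\<^sup>2" using A by (intro power_strict_mono) auto
  then have s2: "s\<^sup>2 = lam\<^sup>2 - \<omega>\<^sup>2" and s: "s > 0" by (simp_all add: s_def)
  have "s\<^sup>2 < (- lam)\<^sup>2" using A by (simp add: s2)
  \<comment> \<open>This makes the smaller root \<open>- lam - s\<close> positive, so that its
    profile decays.\<close>
  then have s': "s < - lam" by (rule power2_less_imp_less) (use A in simp)
  show "(phi lam (k_plus \<omega> lam) :: 'a \<Rightarrow> real) \<noteq> phi lam (k_minus \<omega> lam)"
  proof
    assume "(phi lam (k_plus \<omega> lam) :: 'a \<Rightarrow> real) = phi lam (k_minus \<omega> lam)"
    \<comment> \<open>At the origin only the prefactors remain, and they already determine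
      \<open>k\<close>.\<close>
    then have "phi lam (k_plus \<omega> lam) (0::'a) = phi lam (k_minus \<omega> lam) (0::'a)" by simp
    then show False using A s by (simp add: phi_def k_plus_def k_minus_def s_def)
  qed
  show "\<forall>k\<in>{k_plus \<omega> lam, k_minus \<omega> lam}.
           (\<forall>x::'a. phi lam k x > 0) \<and>
           solution_E \<omega> lam (\<lambda>t (x::'a). of_real (phi lam k x)) \<and>
           continuous_family (\<lambda>\<nu> (x::'a). of_real (phi_nu lam k \<nu> x)) \<and>
           (\<forall>\<nu>. solution_E \<omega> lam (standing_wave \<nu> (\<lambda>x::'a. of_real (phi_nu lam k \<nu> x))) \<and>
                 unstable \<omega> lam (\<lambda>x::'a. of_real (phi_nu lam k \<nu> x)))"
  proof
    fix k assume "k \<in> {k_plus \<omega> lam, k_minus \<omega> lam}"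
    then have k_cases: "k = - lam + s \<or> k = - lam - s"
      unfolding k_plus_def k_minus_def s_def by blast
    \<comment> \<open>Completed square of the equation for \<open>k\<close>, treating both signs
      together.\<close>
    then have "(k + lam)\<^sup>2 = s\<^sup>2" by auto
    then have k: "k > 0" "k\<^sup>2 + 2 * lam * k + \<omega>\<^sup>2 = 0"
      unfolding s2 using k_cases s s' by (linarith, simp add: power2_sum mult_ac)
    have \<omega>: "\<omega> > 0" and lam: "lam \<noteq> 0" using A by auto
    show "(\<forall>x::'a. phi lam k x > 0) \<and>
           solution_E \<omega> lam (\<lambda>t (x::'a). of_real (phi lam k x)) \<and>
           continuous_family (\<lambda>\<nu> (x::'a). of_real (phi_nu lam k \<nu> x)) \<and>
           (\<forall>\<nu>. solution_E \<omega> lam (standing_wave \<nu> (\<lambda>x::'a. of_real (phi_nu lam k \<nu> x))) \<and>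
                 unstable \<omega> lam (\<lambda>x::'a. of_real (phi_nu lam k \<nu> x)))"
      by (intro conjI allI solitary_waves[OF \<omega> k lam]) (simp add: phi_def)
  qed
next
  assume A: "- lam = \<omega> \<and> \<omega> > 0"
  then have lam: "lam = - \<omega>" and \<omega>: "\<omega> > 0" by auto
  show k: "k_minus \<omega> lam = \<omega>" "k_plus \<omega> lam = \<omega>"
    using lam by (simp_all add: k_minus_def k_plus_def)
  have phi: "(phi lam \<omega> :: 'a \<Rightarrow> real) = phi_crit \<omega>"
    using \<omega> by (simp add: fun_eq_iff phi_def phi_crit_def lam)
  have phi_nu: "(phi_nu lam \<omega> \<nu> :: 'a \<Rightarrow> real) = phi_crit_nu \<omega> \<nu>" for \<nu>
    unfolding fun_eq_iff phi_nu_def phi_crit_nu_def phi by (simp add: lam)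
  show "(phi lam (k_minus \<omega> lam) :: 'a \<Rightarrow> real) = phi_crit \<omega>"
    "(phi lam (k_plus \<omega> lam) :: 'a \<Rightarrow> real) = phi_crit \<omega>"
    by (simp_all add: k phi)
  \<comment> \<open>In the critical case \<open>\<omega>\<close> is the double root of the same
    quadratic, so the general result for roots applies.\<close>
  have "\<omega>\<^sup>2 + 2 * lam * \<omega> + \<omega>\<^sup>2 = 0" "lam \<noteq> 0" using \<omega> by (simp_all add: lam power2_eq_square)
  note sw = solitary_waves[OF \<omega> \<omega> this, where 'a = 'a, unfolded phi phi_nu]
  show "solution_E \<omega> lam (\<lambda>t (x::'a). of_real (phi_crit \<omega> x))"
    "continuous_family (\<lambda>\<nu> (x::'a). of_real (phi_crit_nu \<omega> \<nu> x))"
    "\<forall>\<nu>. solution_E \<omega> lam (standing_wave \<nu> (\<lambda>x::'a. of_real (phi_crit_nu \<omega> \<nu> x))) \<and>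
              unstable \<omega> lam (\<lambda>x::'a. of_real (phi_crit_nu \<omega> \<nu> x))"
    using sw by simp_all
qed

end
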